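(* Let $\sigma=(\sigma_1,\dots,\sigma_{2n+1})=(p_0,q_1,p_1,\dots,q_n,p_n)$ be a probability distribution, where $q_1,\dots,q_n$ are the probabilities of successful searches and $p_0,\dots,p_n$ those of unsuccessful searches on an ordered sequence $x_1\prec\dots\prec x_n$. Then the linear-time (i.e. $O(n)$ time) algorithm of De Prisco and De Santis constructs a binary search tree $T$ for $\sigma$ whose cost satisfies $$\mathbb{E}[T]\le H(\sigma)+1+\sum_{i=0}^n p_i-\Bigl(p_0+p_n+\sum_{i=0}^{n-1}\min(p_i,q_{i+1})+\sum_{i=1}^n\min(q_i,p_i)+\sum_{i=0}^{n-1}\min(p_i,p_{i+1})\Bigr),$$ and the right-hand side equals $$H(\sigma)+1+\sum_{i=0}^n p_i-\Bigl(1-\sum_{i=0}^{n-1}\frac{|p_i-q_{i+1}|}{2}-\sum_{i=1}^n\frac{|q_i-p_i|}{2}+\sum_{i=0}^n p_i-\sum_{i=0}^{n-1}\frac{|p_i-p_{i+1}|}{2}\Bigr).$$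
   Context: A binary search tree for $x_1\prec\dots\prec x_n$ is a binary tree with $n$ internal nodes, one for each $x_i$ (identified with its probability $q_i$), and $n+1$ leaves, one for each of the gaps $(-\infty,x_1),(x_1,x_2),\dots,(x_n,+\infty)$ (identified with $p_0,\dots,p_n$), such that the in-order visit gives $p_0,q_1,p_1,\dots,q_n,p_n$. Its cost for $\sigma$ is $\mathbb{E}[T]=\sum_{i=1}^n q_i\,\ell(q_i)+\sum_{i=0}^n p_i\,\ell(p_i)$, where $\ell(q_i)$ is the level of node $q_i$ (number of nodes on the path from the root to $q_i$, so the root has level $1$) and $\ell(p_i)$ is the level of the parent of the leaf $p_i$. $H(\sigma)=-\sum_j\sigma_j\log_2\sigma_j$ is the Shannon entropy (with $0\log_2 0=0$). The algorithm referred to starts from the binary tree of an alphabetic code for $\sigma$, constructed in linear time (a binary tree whose leaves, read from left to right, are $p_0,q_1,p_1,\dots,q_n,p_n$), and turns it into a binary search tree by moving each leaf $q_i$ to the internal node that is the lowest common ancestor of the leaves $p_{i-1}$ and $p_i$. Running time counts elementary operations on numbers (arithmetic, comparisons, floors/ceilings, base-2 logarithms, bitwise XOR) at unit cost. *)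

theory Defs
  imports Complex_Main
begin

section \<open>The distribution\<close>

text \<open>The keys $x_1 \prec \dots \prec x_n$ enter only through their indices. Successful searches have
  probabilities \<open>q 1, \<dots>, q n\<close>, unsuccessful ones \<open>p 0, \<dots>, p n\<close>; values of \<open>p\<close> and \<open>q\<close> outside
  these ranges are irrelevant.\<close>

definition search_distribution :: "nat \<Rightarrow> (nat \<Rightarrow> real) \<Rightarrow> (nat \<Rightarrow> real) \<Rightarrow> bool" where
  "search_distribution n p q \<longleftrightarrow>
     (\<forall>i\<in>{0..n}. 0 \<le> p i) \<and> (\<forall>i\<in>{1..n}. 0 \<le> q i) \<and>
     (\<Sum>i=0..n. p i) + (\<Sum>i=1..n. q i) = 1"

text \<open>\<open>sigma p q j\<close> for \<open>j = 1, \<dots>, 2 n + 1\<close> is the sequence \<open>p 0, q 1, p 1, \<dots>, q n, p n\<close>.\<close>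

definition sigma :: "(nat \<Rightarrow> real) \<Rightarrow> (nat \<Rightarrow> real) \<Rightarrow> nat \<Rightarrow> real" where
  "sigma p q j = (if even j then q (j div 2) else p (j div 2))"

definition entropy :: "nat \<Rightarrow> (nat \<Rightarrow> real) \<Rightarrow> (nat \<Rightarrow> real) \<Rightarrow> real" where
  "entropy n p q = - (\<Sum>j=1..2*n+1. sigma p q j * log 2 (sigma p q j))"


section \<open>Trees\<close>

text \<open>\<open>Q i\<close> is the key $x_i$; \<open>P i\<close> is the gap between $x_i$ and $x_{i+1}$
  (unbounded on one side for \<open>i = 0\<close> and \<open>i = n\<close>).\<close>

datatype item = P nat | Q nat

definition items_in_order :: "nat \<Rightarrow> item list" where
  "items_in_order n = P 0 # concat (map (\<lambda>i. [Q i, P i]) [1..<n+1])"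

datatype bst = Leaf nat | Node bst nat bst

fun inorder :: "bst \<Rightarrow> item list" where
  "inorder (Leaf i) = [P i]"
| "inorder (Node l i r) = inorder l @ [Q i] @ inorder r"

definition search_tree :: "nat \<Rightarrow> bst \<Rightarrow> bool" where
  "search_tree n T \<longleftrightarrow> inorder T = items_in_order n"

text \<open>\<open>level T x\<close> counts the internal nodes on the path from the root of \<open>T\<close> to \<open>x\<close>. For a key this
  includes its own node; for a gap the last internal node on the path is the parent of the leaf, so
  the count is the level of that parent.\<close>

fun level :: "bst \<Rightarrow> item \<Rightarrow> nat" where
  "level (Leaf i) x = 0"
| "level (Node l i r) x =
     (if x = Q i then 1 else if x \<in> set (inorder l) then 1 + level l x else 1 + level r x)"

definition cost :: "nat \<Rightarrow> (nat \<Rightarrow> real) \<Rightarrow> (nat \<Rightarrow> real) \<Rightarrow> bst \<Rightarrow> real" where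
  "cost n p q T =
     (\<Sum>i=1..n. q i * real (level T (Q i))) + (\<Sum>i=0..n. p i * real (level T (P i)))"

datatype code_tree = Tip item | Fork code_tree code_tree

fun leaves :: "code_tree \<Rightarrow> item list" where
  "leaves (Tip x) = [x]"
| "leaves (Fork l r) = leaves l @ leaves r"

definition alphabetic_tree :: "nat \<Rightarrow> code_tree \<Rightarrow> bool" where
  "alphabetic_tree n A \<longleftrightarrow> leaves A = items_in_order n"

text \<open>\<open>root_is_lca A x y\<close>: the root of \<open>A\<close> is the lowest common ancestor of the leaves \<open>x\<close> and \<open>y\<close>.\<close>

fun root_is_lca :: "code_tree \<Rightarrow> item \<Rightarrow> item \<Rightarrow> bool" where
  "root_is_lca (Tip z) x y \<longleftrightarrow> x = z \<and> y = z"
| "root_is_lca (Fork l r) x y \<longleftrightarrow>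
     {x, y} \<subseteq> set (leaves (Fork l r)) \<and>
     \<not> {x, y} \<subseteq> set (leaves l) \<and> \<not> {x, y} \<subseteq> set (leaves r)"

text \<open>Every leaf \<open>Q i\<close> leaves its place and becomes the label of the internal node that is the lowest
  common ancestor of \<open>P (i - 1)\<close> and \<open>P i\<close>; an internal node that loses a child in this way is
  replaced by its other child. \<open>None\<close> is the empty tree left behind by a \<open>Q\<close> leaf.\<close>

fun move_to_lca :: "code_tree \<Rightarrow> bst option" where
  "move_to_lca (Tip (P i)) = Some (Leaf i)"
| "move_to_lca (Tip (Q i)) = None"
| "move_to_lca (Fork l r) =
     (case (move_to_lca l, move_to_lca r) of
        (None, T) \<Rightarrow> T
      | (T, None) \<Rightarrow> T
      | (Some L, Some R) \<Rightarrow>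
          Some (Node L (THE i. 1 \<le> i \<and> root_is_lca (Fork l r) (P (i - 1)) (P i)) R))"


section \<open>The machine model\<close>

text \<open>Programs are finite lists of recursive one-argument procedures over exact real numbers, immutable
  pairs (heap cells passed by reference) and a random-access memory. Every construct costs one time
  unit plus the cost of the subexpressions that are evaluated. Only integer constants may occur in a
  program.\<close>

datatype val = VNum real | VPair val val

type_synonym memory = "nat \<Rightarrow> val"

datatype unop = Floor | Ceil | Log2

datatype binop = Add | Sub | Mul | Divide | Less | Equal | Xor

fun unop_sem :: "unop \<Rightarrow> real \<Rightarrow> real" where
  "unop_sem Floor x = of_int \<lfloor>x\<rfloor>"
| "unop_sem Ceil x = of_int \<lceil>x\<rceil>"
| "unop_sem Log2 x = log 2 x"

text \<open>\<open>Xor\<close> acts bitwise on integers; other arguments are rounded down first.\<close>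

fun binop_sem :: "binop \<Rightarrow> real \<Rightarrow> real \<Rightarrow> real" where
  "binop_sem Add x y = x + y"
| "binop_sem Sub x y = x - y"
| "binop_sem Mul x y = x * y"
| "binop_sem Divide x y = x / y"
| "binop_sem Less x y = of_bool (x < y)"
| "binop_sem Equal x y = of_bool (x = y)"
| "binop_sem Xor x y = of_int (Bit_Operations.xor \<lfloor>x\<rfloor> \<lfloor>y\<rfloor>)"

text \<open>Variables are de Bruijn indices: \<open>Bind a b\<close> evaluates \<open>a\<close> and then \<open>b\<close> with the value of \<open>a\<close> as
  variable \<open>0\<close>; a procedure body starts with its argument as its only variable.\<close>

datatype expr =
    Var nat
  | Const int
  | Op1 unop expr
  | Op2 binop expr expr
  | MkPair expr expr
  | First expr
  | Second expr
  | Load expr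
  | Store expr expr
  | Bind expr expr
  | Cond expr expr expr
  | Call nat expr

type_synonym program = "expr list"

text \<open>\<open>eval Pr \<rho> \<mu> e v \<mu>' t\<close>: in environment \<open>\<rho>\<close> and memory \<open>\<mu>\<close>, the expression \<open>e\<close> evaluates to \<open>v\<close>
  in time \<open>t\<close> and leaves memory \<open>\<mu>'\<close>.\<close>

inductive eval ::
  "program \<Rightarrow> val list \<Rightarrow> memory \<Rightarrow> expr \<Rightarrow> val \<Rightarrow> memory \<Rightarrow> nat \<Rightarrow> bool" for Pr where
  Var: "i < length \<rho> \<Longrightarrow> eval Pr \<rho> \<mu> (Var i) (\<rho> ! i) \<mu> 1"
| Const: "eval Pr \<rho> \<mu> (Const c) (VNum (of_int c)) \<mu> 1"
| Op1: "eval Pr \<rho> \<mu> e (VNum x) \<mu>' t \<Longrightarrow>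
       eval Pr \<rho> \<mu> (Op1 f e) (VNum (unop_sem f x)) \<mu>' (t + 1)"
| Op2: "eval Pr \<rho> \<mu> a (VNum x) \<mu>' s \<Longrightarrow> eval Pr \<rho> \<mu>' b (VNum y) \<mu>'' t \<Longrightarrow>
       eval Pr \<rho> \<mu> (Op2 f a b) (VNum (binop_sem f x y)) \<mu>'' (s + t + 1)"
| MkPair: "eval Pr \<rho> \<mu> a v \<mu>' s \<Longrightarrow> eval Pr \<rho> \<mu>' b w \<mu>'' t \<Longrightarrow>
       eval Pr \<rho> \<mu> (MkPair a b) (VPair v w) \<mu>'' (s + t + 1)"
| First: "eval Pr \<rho> \<mu> e (VPair v w) \<mu>' t \<Longrightarrow> eval Pr \<rho> \<mu> (First e) v \<mu>' (t + 1)"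
| Second: "eval Pr \<rho> \<mu> e (VPair v w) \<mu>' t \<Longrightarrow> eval Pr \<rho> \<mu> (Second e) w \<mu>' (t + 1)"
| Load: "eval Pr \<rho> \<mu> e (VNum (of_nat a)) \<mu>' t \<Longrightarrow> eval Pr \<rho> \<mu> (Load e) (\<mu>' a) \<mu>' (t + 1)"
| Store: "eval Pr \<rho> \<mu> e (VNum (of_nat a)) \<mu>' s \<Longrightarrow> eval Pr \<rho> \<mu>' b v \<mu>'' t \<Longrightarrow>
       eval Pr \<rho> \<mu> (Store e b) v (\<mu>''(a := v)) (s + t + 1)"
| Bind: "eval Pr \<rho> \<mu> a v \<mu>' s \<Longrightarrow> eval Pr (v # \<rho>) \<mu>' b w \<mu>'' t \<Longrightarrow>
       eval Pr \<rho> \<mu> (Bind a b) w \<mu>'' (s + t + 1)"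
| Cond_true: "eval Pr \<rho> \<mu> c (VNum x) \<mu>' s \<Longrightarrow> x \<noteq> 0 \<Longrightarrow> eval Pr \<rho> \<mu>' a v \<mu>'' t \<Longrightarrow>
       eval Pr \<rho> \<mu> (Cond c a b) v \<mu>'' (s + t + 1)"
| Cond_false: "eval Pr \<rho> \<mu> c (VNum 0) \<mu>' s \<Longrightarrow> eval Pr \<rho> \<mu>' b v \<mu>'' t \<Longrightarrow>
       eval Pr \<rho> \<mu> (Cond c a b) v \<mu>'' (s + t + 1)"
| Call: "eval Pr \<rho> \<mu> e v \<mu>' s \<Longrightarrow> f < length Pr \<Longrightarrow> eval Pr [v] \<mu>' (Pr ! f) w \<mu>'' t \<Longrightarrow>
       eval Pr \<rho> \<mu> (Call f e) w \<mu>'' (s + t + 1)"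

text \<open>\<open>runs Pr f v \<mu> w \<mu>' t\<close>: procedure number \<open>f\<close>, applied to \<open>v\<close> in memory \<open>\<mu>\<close>, returns \<open>w\<close> in
  time \<open>t\<close> and leaves memory \<open>\<mu>'\<close>.\<close>

definition runs ::
  "program \<Rightarrow> nat \<Rightarrow> val \<Rightarrow> memory \<Rightarrow> val \<Rightarrow> memory \<Rightarrow> nat \<Rightarrow> bool" where
  "runs Pr f v \<mu> w \<mu>' t \<longleftrightarrow> f < length Pr \<and> eval Pr [v] \<mu> (Pr ! f) w \<mu>' t"

text \<open>The input occupies the memory cells \<open>1, \<dots>, 2 n + 1\<close>; all other cells initially contain 0.\<close>

definition input_memory :: "nat \<Rightarrow> (nat \<Rightarrow> real) \<Rightarrow> (nat \<Rightarrow> real) \<Rightarrow> memory" where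
  "input_memory n p q j = VNum (if 1 \<le> j \<and> j \<le> 2*n+1 then sigma p q j else 0)"

text \<open>Trees are stored as linked structures; the first component of a pair is a tag.\<close>

fun code_tree_val :: "code_tree \<Rightarrow> val" where
  "code_tree_val (Tip (P i)) = VPair (VNum 0) (VNum (of_nat i))"
| "code_tree_val (Tip (Q i)) = VPair (VNum 1) (VNum (of_nat i))"
| "code_tree_val (Fork l r) = VPair (VNum 2) (VPair (code_tree_val l) (code_tree_val r))"

fun bst_val :: "bst \<Rightarrow> val" where
  "bst_val (Leaf i) = VPair (VNum 0) (VNum (of_nat i))"
| "bst_val (Node l i r) =
     VPair (VNum 1) (VPair (VNum (of_nat i)) (VPair (bst_val l) (bst_val r)))"

end

theory Submission
  imports Defs "HOL-Analysis.Convex"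
begin

text \<open>The alphabetic tree is weight-balanced: a segment of leaves is split next to a leaf whose weight
  interval contains the midpoint of the segment, so the weights \<open>a\<close>, \<open>b\<close> of the two sides differ by at
  most the larger of the two leaves at the split. Since \<open>a log a + b log b + a + b \<le> (a + b) log (a + b)
  + \<bar>a - b\<bar>\<close>, induction bounds the path length by the entropy plus 2, minus the two outer weights, minus the
  minima of adjacent weights. Moving \<open>Q i\<close> upwards deletes its parent; this saves at least \<open>q i\<close>
  for the key and \<open>min (p (i - 1)) (p i)\<close> for the neighbouring gap in the sibling subtree.

  On prefix sums a split is found by galloping from both ends, in time
  \<open>O(1 + log (min m m'))\<close> for parts of \<open>m\<close> and \<open>m'\<close> leaves, which sums up to linear time; neither
  logarithms nor bitwise operations are needed.\<close>

section \<open>Weight-balanced alphabetic trees\<close>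

text \<open>The gain \<open>2 * a\<close> comes in two halves. The smaller weight gains
  \<open>a\<close> because \<open>a + b\<close> is at least \<open>2 * a\<close>. The larger one
  gains \<open>b * log 2 (1 + a / b)\<close>, which is at least \<open>a\<close>: by concavity
  \<open>log 2 (1 + y)\<close> lies above its chord \<open>y\<close> on [0,1].\<close>

lemma add_le_mul_log_add:
  fixes a b :: real
  assumes "0 \<le> a" "a \<le> b"
  shows "a * log 2 a + b * log 2 b + 2 * a \<le> (a + b) * log 2 (a + b)"
proof (cases "a = 0")
  case False
  with assms have pos: "0 < a" "0 < b" by simp_all
  have 1: "log 2 a + 1 \<le> log 2 (a + b)"
  proof -
    have "log 2 a + 1 = log 2 (2 * a)"
      using pos by (simp add: log_mult)
    also have "\<dots> \<le> log 2 (a + b)"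
      using pos assms by (subst log_le_cancel_iff) auto
    finally show ?thesis .
  qed
  have 2: "a / b \<le> log 2 (1 + a / b)"
  proof -
    define y where "y = a / b"
    have y: "0 \<le> y" "y \<le> 1" using pos assms by (auto simp: y_def)
    show ?thesis
      using concave_onD[OF log_concave[of 2], of y 1 2] y by (simp add: y_def[symmetric] add.commute)
  qed
  have "log 2 (a + b) = log 2 b + log 2 (1 + a / b)"
  proof -
    have "a + b = b * (1 + a / b)" using pos by (simp add: field_simps)
    then show ?thesis
      using pos log_mult_pos[of b "1 + a / b" 2] by (simp add: add_pos_pos)
  qed
  then have "b * log 2 (a + b) = b * log 2 b + b * log 2 (1 + a / b)"
    by (simp add: distrib_left)
  moreover have "b * log 2 (1 + a / b) \<ge> b * (a / b)"
    using 2 pos by (intro mult_left_mono) auto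
  moreover have "b * (a / b) = a" using pos by simp
  moreover have "a * log 2 (a + b) \<ge> a * (log 2 a + 1)"
    using 1 pos by (intro mult_left_mono) auto
  ultimately show ?thesis
    by (simp add: algebra_simps)
qed simp

text \<open>Symmetric form, since twice the smaller weight is
  \<open>a + b - \<bar>a - b\<bar>\<close>.\<close>

lemma add_le_mul_log_add':
  fixes a b :: real
  assumes "0 \<le> a" "0 \<le> b"
  shows "a * log 2 a + b * log 2 b + (a + b) \<le> (a + b) * log 2 (a + b) + \<bar>a - b\<bar>"
  using add_le_mul_log_add[of a b] add_le_mul_log_add[of b a] assms
  by (cases "a \<le> b") (auto simp: add.commute)

text \<open>Positions count from 0: leaf \<open>x\<close> carries \<open>sigma p q (Suc x)\<close>.\<close>

definition item :: "nat \<Rightarrow> item" where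
  "item x = (if even x then P (x div 2) else Q (Suc (x div 2)))"

text \<open>This is the weighted external path length (weight times depth, summed over the leaves),
  written as a sum over the forks to suit the inductions.\<close>

fun path_weight :: "(item \<Rightarrow> real) \<Rightarrow> code_tree \<Rightarrow> real" where
  "path_weight u (Tip x) = 0"
| "path_weight u (Fork l r) =
     sum_list (map u (leaves l @ leaves r)) + path_weight u l + path_weight u r"

text \<open>A relation rather than a function: several splits may meet the balance condition, and
  the analysis applies to whichever one the program finds.\<close>

inductive balanced :: "(nat \<Rightarrow> real) \<Rightarrow> nat \<Rightarrow> nat \<Rightarrow> code_tree \<Rightarrow> bool" for w where
  Tip: "balanced w x (Suc x) (Tip (item x))"
| Fork: "balanced w a (Suc k) l \<Longrightarrow> balanced w (Suc k) b r \<Longrightarrow>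
    \<bar>sum w {a..<Suc k} - sum w {Suc k..<b}\<bar> \<le> max (w k) (w (Suc k)) \<Longrightarrow>
    balanced w a b (Fork l r)"

lemma balanced_less: "balanced w a b A \<Longrightarrow> a < b"
  by (induction rule: balanced.induct) auto

lemma upt_append_split: "a \<le> k \<Longrightarrow> k \<le> b \<Longrightarrow> [a..<b] = [a..<k] @ [k..<b]"
  using upt_add_eq_append[of a k "b - k"] by simp

lemma leaves_balanced: "balanced w a b A \<Longrightarrow> leaves A = map item [a..<b]"
proof (induction rule: balanced.induct)
  case (Fork a k l b r)
  have "[a..<b] = [a..<Suc k] @ [Suc k..<b]"
    using balanced_less[OF Fork.hyps(1)] balanced_less[OF Fork.hyps(2)]
    by (intro upt_append_split) auto
  then show ?case
    using Fork.IH by (simp del: upt_Suc)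
qed simp

text \<open>For a single leaf both sides are 0. At a fork the imbalance is at most
  \<open>max (w k) (w (Suc k))\<close>, which is \<open>w k + w (Suc k)\<close> minus their minimum.
  The induction hypotheses subtract \<open>w k\<close> and \<open>w (Suc k)\<close> as outer weights
  of the two parts; these pay for the imbalance and leave the minimum of the new adjacent pair as
  profit.\<close>

lemma path_weight_balanced:
  assumes "balanced w a b A" "\<And>x. a \<le> x \<Longrightarrow> x < b \<Longrightarrow> 0 \<le> w x"
    "\<And>x. a \<le> x \<Longrightarrow> x < b \<Longrightarrow> u (item x) = w x"
  shows "path_weight u A \<le>
    sum w {a..<b} * log 2 (sum w {a..<b}) - (\<Sum>x=a..<b. w x * log 2 (w x))
    + 2 * sum w {a..<b} - w a - w (b - 1) - (\<Sum>x=a..<b - 1. min (w x) (w (Suc x)))"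
  using assms
proof (induction rule: balanced.induct)
  case (Tip x)
  then show ?case by simp
next
  case (Fork a k l b r)
  have less: "a < Suc k" "Suc k < b"
    using balanced_less Fork.hyps by blast+
  have split: "sum f {a..<b} = sum f {a..<Suc k} + sum f {Suc k..<b}" for f :: "nat \<Rightarrow> real"
    using less sum.atLeastLessThan_concat[of a "Suc k" b f] by simp
  let ?g = "\<lambda>x. min (w x) (w (Suc x))"
  have "sum ?g {a..<b - 1} = sum ?g {a..<Suc k} + sum ?g {Suc k..<b - 1}"
    using less by (intro sum.atLeastLessThan_concat[symmetric]) auto
  also have "sum ?g {a..<Suc k} = sum ?g {a..<k} + ?g k"
    using less by simp
  finally have mins: "sum ?g {a..<b - 1} = sum ?g {a..<k} + ?g k + sum ?g {Suc k..<b - 1}" .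
  have lv: "sum_list (map u (leaves l @ leaves r)) = sum w {a..<b}"
  proof -
    have "leaves l @ leaves r = map item [a..<b]"
      using leaves_balanced[OF balanced.Fork[OF Fork.hyps]] by simp
    moreover have "sum_list (map u (map item [a..<b])) = sum_list (map w [a..<b])"
      using Fork.prems by (intro arg_cong[where f = sum_list]) auto
    ultimately show ?thesis
      by (simp add: interv_sum_list_conv_sum_set_nat)
  qed
  have nonneg: "0 \<le> sum w {a..<Suc k}" "0 \<le> sum w {Suc k..<b}"
    by (rule sum_nonneg, use Fork.prems less in auto)+
  define W1 W2 m where "W1 = sum w {a..<Suc k}" and "W2 = sum w {Suc k..<b}" and "m = ?g k"
  have "\<bar>W1 - W2\<bar> \<le> w k + w (Suc k) - m"
    using Fork.hyps(3) by (simp add: W1_def W2_def m_def max_def min_def split: if_splits)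
  then have step: "W1 * log 2 W1 + W2 * log 2 W2 + (W1 + W2)
      \<le> (W1 + W2) * log 2 (W1 + W2) + (w k + w (Suc k) - m)"
    using add_le_mul_log_add'[OF nonneg] unfolding W1_def W2_def by simp
  have "path_weight u l \<le>
    sum w {a..<Suc k} * log 2 (sum w {a..<Suc k}) - (\<Sum>x=a..<Suc k. w x * log 2 (w x))
    + 2 * sum w {a..<Suc k} - w a - w k - sum ?g {a..<k}"
    using Fork.IH(1) Fork.prems less by simp
  moreover have "path_weight u r \<le>
    sum w {Suc k..<b} * log 2 (sum w {Suc k..<b}) - (\<Sum>x=Suc k..<b. w x * log 2 (w x))
    + 2 * sum w {Suc k..<b} - w (Suc k) - w (b - 1) - sum ?g {Suc k..<b - 1}"
    using Fork.IH(2) Fork.prems less by simp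
  ultimately show ?case
    using step unfolding path_weight.simps lv mins split[of w] split[of "\<lambda>x. w x * log 2 (w x)"]
      W1_def[symmetric] W2_def[symmetric] m_def[symmetric]
    by argo
qed

section \<open>Moving the keys to lowest common ancestors\<close>

lemma leaves_nonempty: "leaves A \<noteq> []"
  by (induction A) auto

text \<open>Supplies the cut position \<open>k\<close> in every later induction over a tree whose
  leaves form a segment.\<close>

lemma leaves_Fork_segment:
  assumes "leaves (Fork l r) = map item [a..<b]"
  obtains k where "a < k" "k < b" "leaves l = map item [a..<k]" "leaves r = map item [k..<b]"
proof -
  define k where "k = a + length (leaves l)"
  have len: "length (leaves l) + length (leaves r) = b - a"
    using arg_cong[OF assms, of length] by simp
  have ne: "length (leaves l) > 0" "length (leaves r) > 0"
    using leaves_nonempty by auto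
  then have k: "a < k" "k < b"
    using len unfolding k_def by linarith+
  have eq: "leaves l @ leaves r = map item [a..<k] @ map item [k..<b]"
    using assms k upt_append_split[of a k b] by simp
  have "length (leaves l) = length (map item [a..<k]) \<or>
      length (leaves r) = length (map item [k..<b])"
    by (simp add: k_def)
  from iffD1[OF append_eq_append_conv[OF this] eq]
  have "leaves l = map item [a..<k]" "leaves r = map item [k..<b]"
    by (rule conjunct1, rule conjunct2)
  with k show ?thesis
    by (rule that)
qed

lemma P_in_segment: "P j \<in> item ` {a..<b} \<longleftrightarrow> a \<le> 2 * j \<and> 2 * j < b"
proof -
  have "P j = item x \<longleftrightarrow> x = 2 * j" for x
    by (auto simp: item_def)
  then show ?thesis
    by (auto simp: image_iff)
qed

lemma inj_item: "inj item"
proof (rule injI)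
  fix x y assume "item x = item y"
  then have "even x = even y \<and> x div 2 = y div 2"
    by (auto simp: item_def split: if_splits)
  moreover have "x = 2 * (x div 2) + x mod 2" "y = 2 * (y div 2) + y mod 2"
    by simp_all
  ultimately show "x = y" by (metis parity_cases)
qed

text \<open>Gaps sit at even positions, so exactly one pair of consecutive gaps straddles the cut
  \<open>k\<close>. The last two assumptions exclude a side that is a single key, hence without a
  gap; such a fork disappears in the contraction.\<close>

lemma label_Fork_segment:
  assumes "leaves l = map item [a..<k]" "leaves r = map item [k..<b]" "a < k" "k < b"
    "\<not> (odd a \<and> k = Suc a)" "\<not> (odd k \<and> b = Suc k)"
  shows "(THE i. 1 \<le> i \<and> root_is_lca (Fork l r) (P (i - 1)) (P i)) = Suc k div 2"
proof -
  have in_l: "P j \<in> set (leaves l) \<longleftrightarrow> a \<le> 2 * j \<and> 2 * j < k" for j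
    using assms by (simp add: P_in_segment)
  have in_r: "P j \<in> set (leaves r) \<longleftrightarrow> k \<le> 2 * j \<and> 2 * j < b" for j
    using assms by (simp add: P_in_segment)
  have "root_is_lca (Fork l r) (P j) (P (Suc j)) \<longleftrightarrow> Suc j = Suc k div 2" for j
  proof -
    have "root_is_lca (Fork l r) (P j) (P (Suc j)) \<longleftrightarrow> 2 * j < k \<and> k \<le> 2 * Suc j"
      using assms(3-6) by (auto simp: in_l in_r; presburger)
    then show ?thesis by auto
  qed
  then have "1 \<le> i \<and> root_is_lca (Fork l r) (P (i - 1)) (P i) \<longleftrightarrow> i = Suc k div 2" for i
    using assms(3) by (cases i) auto
  then show ?thesis
    by simp
qed

text \<open>A key at either end of a segment has only one of its gaps inside, so its lowest common
  ancestor lies further up and the key leaves the segment. \<open>first_gap\<close> is an inclusive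
  bound of what remains, \<open>last_gap\<close> an exclusive one.\<close>

definition first_gap :: "nat \<Rightarrow> nat" where
  "first_gap a = (if even a then a else Suc a)"

definition last_gap :: "nat \<Rightarrow> nat" where
  "last_gap b = (if odd b then b else b - 1)"

text \<open>Exactly one key touches the cut: it ends the left part or starts the right one,
  depending on the parity of \<open>k\<close>. It is missing from both contracted parts and returns
  as the label of the fork, hence \<open>Suc (last_gap k) = first_gap k\<close>.\<close>

lemma move_to_lca_segment:
  assumes "leaves A = map item [a..<b]"
  shows "if odd a \<and> b = Suc a then move_to_lca A = None
    else \<exists>T. move_to_lca A = Some T \<and> inorder T = map item [first_gap a..<last_gap b]"
  using assms
proof (induction A arbitrary: a b)
  case (Tip x)
  then have "b - a = 1"
    by (metis One_nat_def leaves.simps(1) length_Cons length_map length_upt list.size(3))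
  then have b: "b = Suc a" by simp
  with Tip have "x = item a" by simp
  with b show ?case
    by (auto simp: item_def first_gap_def last_gap_def)
next
  case (Fork l r)
  obtain k where k: "a < k" "k < b" "leaves l = map item [a..<k]" "leaves r = map item [k..<b]"
    using leaves_Fork_segment[OF Fork.prems] by blast
  note IH = Fork.IH(1)[OF k(3)] Fork.IH(2)[OF k(4)]
  consider "odd a" "k = Suc a" | "odd k" "b = Suc k"
    | "\<not> (odd a \<and> k = Suc a)" "\<not> (odd k \<and> b = Suc k)"
    by blast
  then show ?case
  proof cases
    case 1
    with IH k obtain R where "move_to_lca l = None" "move_to_lca r = Some R"
      "inorder R = map item [first_gap k..<last_gap b]"
      by auto
    with 1 k show ?thesis by (auto simp: first_gap_def)
  next
    case 2
    with IH k obtain L where "move_to_lca r = None" "move_to_lca l = Some L"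
      "inorder L = map item [first_gap a..<last_gap k]"
      by (auto split: if_splits)
    with 2 k show ?thesis by (auto simp: last_gap_def)
  next
    case 3
    then obtain L R where LR: "move_to_lca l = Some L" "move_to_lca r = Some R"
      "inorder L = map item [first_gap a..<last_gap k]"
      "inorder R = map item [first_gap k..<last_gap b]"
      using IH by auto
    have gaps: "first_gap a \<le> last_gap k" "last_gap k < last_gap b" "Suc (last_gap k) = first_gap k"
      using k(1,2) 3 unfolding first_gap_def last_gap_def by presburger+
    have "[first_gap a..<last_gap b] = [first_gap a..<last_gap k] @ [last_gap k..<last_gap b]"
      using gaps by (intro upt_append_split) auto
    moreover have "[last_gap k..<last_gap b] = last_gap k # [first_gap k..<last_gap b]"
      using gaps by (simp add: upt_conv_Cons)
    moreover have "item (last_gap k) = Q (Suc k div 2)"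
      using k by (auto simp: last_gap_def item_def elim!: oddE evenE)
    ultimately show ?thesis
      using 3 k LR label_Fork_segment[OF k(3,4,1,2) 3] by (auto simp: Let_def)
  qed
qed

section \<open>Cost of search trees and the saving from moving the keys\<close>

definition bst_weight :: "(item \<Rightarrow> real) \<Rightarrow> bst \<Rightarrow> real" where
  "bst_weight u T = sum_list (map (\<lambda>x. u x * real (level T x)) (inorder T))"

text \<open>A new root raises every level below it by one. Distinctness ensures that the membership
  test in \<open>level\<close> descends to the correct side.\<close>

lemma bst_weight_Node:
  assumes "distinct (inorder (Node l i r))"
  shows "bst_weight u (Node l i r) =
    sum_list (map u (inorder (Node l i r))) + bst_weight u l + bst_weight u r"
proof -
  define f where "f = (\<lambda>x. u x * real (level (Node l i r) x))"
  have eqs: "map f (inorder l) = map (\<lambda>x. u x + u x * real (level l x)) (inorder l)"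
    "map f (inorder r) = map (\<lambda>x. u x + u x * real (level r x)) (inorder r)"
    "f (Q i) = u (Q i)"
    using assms by (auto simp: f_def algebra_simps)
  have "bst_weight u (Node l i r) = sum_list (map f (inorder (Node l i r)))"
    by (simp only: bst_weight_def f_def)
  also have "\<dots> = sum_list (map f (inorder l)) + f (Q i) + sum_list (map f (inorder r))"
    by simp
  also have "\<dots> = sum_list (map u (inorder (Node l i r))) + bst_weight u l + bst_weight u r"
    unfolding eqs by (simp add: bst_weight_def sum_list_addf)
  finally show ?thesis .
qed

text \<open>In a segment of length at least 2 starting or ending with a key, the only neighbour of that key stands in
  for the missing one, so that the minimum is the weight of the existing neighbour. A single key saves nothing
  yet, hence the case distinction in \<open>saving\<close>.\<close>

definition saving_term :: "(nat \<Rightarrow> real) \<Rightarrow> nat \<Rightarrow> nat \<Rightarrow> nat \<Rightarrow> real" where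
  "saving_term w a b x = (if odd x then
     w x + min (w (if a < x then x - 1 else Suc x)) (w (if Suc x < b then Suc x else x - 1))
   else 0)"

definition saving :: "(nat \<Rightarrow> real) \<Rightarrow> nat \<Rightarrow> nat \<Rightarrow> real" where
  "saving w a b = (if b = Suc a then 0 else sum (saving_term w a b) {a..<b})"

text \<open>Cutting at \<open>k\<close> can only deprive a key at position \<open>k - 1\<close> of
  its right neighbour. Its minimum then becomes the weight of the left neighbour, which is no
  smaller.\<close>

lemma saving_left:
  assumes "a < k" "k < b" "\<not> (odd a \<and> k = Suc a)"
  shows "sum (saving_term w a b) {a..<k} \<le> saving w a k"
proof (cases "k = Suc a")
  case True
  with assms show ?thesis by (simp add: saving_def saving_term_def)
next
  case False
  then have "saving_term w a b x \<le> saving_term w a k x" if "x \<in> {a..<k}" for x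
    using assms that by (auto simp: saving_term_def)
  then have "sum (saving_term w a b) {a..<k} \<le> sum (saving_term w a k) {a..<k}"
    by (rule sum_mono)
  then show ?thesis
    using False by (simp add: saving_def)
qed

lemma saving_right:
  assumes "a < k" "k < b" "\<not> (odd k \<and> b = Suc k)"
  shows "sum (saving_term w a b) {k..<b} \<le> saving w k b"
proof (cases "b = Suc k")
  case True
  with assms show ?thesis by (simp add: saving_def saving_term_def)
next
  case False
  then have "saving_term w a b x \<le> saving_term w k b x" if "x \<in> {k..<b}" for x
    using assms that by (auto simp: saving_term_def)
  then have "sum (saving_term w a b) {k..<b} \<le> sum (saving_term w k b) {k..<b}"
    by (rule sum_mono)
  then show ?thesis
    using False by (simp add: saving_def)
qed

lemma sum_list_segment:
  assumes "\<And>x. a \<le> x \<Longrightarrow> x < b \<Longrightarrow> u (item x) = w x"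
  shows "sum_list (map u (map item [a..<b])) = sum w {a..<b}"
proof -
  have "map u (map item [a..<b]) = map w [a..<b]"
    using assms by simp
  then show ?thesis
    by (simp only: interv_sum_list_conv_sum_set_nat)  simp
qed

text \<open>Each fork contributes the weight of its whole segment to \<open>path_weight\<close>. If
  a fork disappears, that weight is saved entirely and covers the saving of the key at the boundary.
  If it survives, its node costs at most the same weight, and the savings of the two parts add
  up.\<close>

lemma bst_weight_add_saving_le:
  assumes "leaves A = map item [a..<b]" "move_to_lca A = Some T"
    "\<And>x. a \<le> x \<Longrightarrow> x < b \<Longrightarrow> 0 \<le> w x" "\<And>x. a \<le> x \<Longrightarrow> x < b \<Longrightarrow> u (item x) = w x"
  shows "bst_weight u T + saving w a b \<le> path_weight u A"
  using assms
proof (induction A arbitrary: a b T)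
  case (Tip x)
  then have "b - a = 1"
    by (metis One_nat_def leaves.simps(1) length_Cons length_map length_upt list.size(3))
  then have b: "b = Suc a" by simp
  with Tip show ?case
    by (auto simp: saving_def bst_weight_def item_def split: if_splits)
next
  case (Fork l r)
  obtain k where k: "a < k" "k < b" "leaves l = map item [a..<k]" "leaves r = map item [k..<b]"
    using leaves_Fork_segment[OF Fork.prems(1)] by blast
  note shape = move_to_lca_segment[OF k(3)] move_to_lca_segment[OF k(4)]
  have W: "sum_list (map u (leaves l @ leaves r)) = sum w {a..<b}"
    using Fork.prems(1) sum_list_segment[of a b u w] Fork.prems(4) by simp
  have sub: "sum w X \<le> sum w {a..<b}" if "X \<subseteq> {a..<b}" for X
    using that Fork.prems(3) by (intro sum_mono2) auto
  have sav: "saving w a b = sum (saving_term w a b) {a..<k} + sum (saving_term w a b) {k..<b}"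
    using k by (simp add: saving_def sum.atLeastLessThan_concat)
  have IHl: "bst_weight u L + saving w a k \<le> path_weight u l" if "move_to_lca l = Some L" for L
    using Fork.IH(1)[OF k(3) that] Fork.prems(3,4) k by simp
  have IHr: "bst_weight u R + saving w k b \<le> path_weight u r" if "move_to_lca r = Some R" for R
    using Fork.IH(2)[OF k(4) that] Fork.prems(3,4) k by simp
  consider "odd a" "k = Suc a" | "odd k" "b = Suc k"
    | "\<not> (odd a \<and> k = Suc a)" "\<not> (odd k \<and> b = Suc k)"
    by blast
  then show ?case
  proof cases
    case 1
    have "length (leaves l) = 1" using k 1 by simp
    then have "path_weight u l = 0" using leaves_nonempty by (cases l) (auto simp: add_eq_if split: if_splits)
    moreover have "move_to_lca r = Some T"
      using shape 1 k Fork.prems(2) by (auto split: option.splits)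
    \<comment> \<open>The key at \<open>a\<close> has only the right neighbour in the segment, so
      both arguments of the minimum are \<open>w (Suc a)\<close>.\<close>
    moreover have "saving_term w a b a \<le> sum w {a, Suc a}"
      using 1 k by (simp add: saving_term_def)
    moreover have "sum w {a, Suc a} \<le> sum w {a..<b}"
      using 1 k by (intro sub) auto
    moreover have "sum (saving_term w a b) {a..<k} = saving_term w a b a"
      using 1 by simp
    moreover have "sum (saving_term w a b) {k..<b} \<le> saving w k b"
      using 1 k by (intro saving_right) auto
    ultimately show ?thesis
      using IHr[of T] unfolding path_weight.simps W sav by linarith
  next
    case 2
    have "length (leaves r) = 1" using k 2 by simp
    then have "path_weight u r = 0" using leaves_nonempty by (cases r) (auto simp: add_eq_if split: if_splits)
    moreover have "move_to_lca l = Some T"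
      using shape 2 k Fork.prems(2) by (auto split: option.splits)
    moreover have "saving_term w a b k \<le> sum w {k - 1, k}"
      using 2 k by (simp add: saving_term_def)
    moreover have "sum w {k - 1, k} \<le> sum w {a..<b}"
      using 2 k by (intro sub) auto
    moreover have "sum (saving_term w a b) {k..<b} = saving_term w a b k"
      using 2 by simp
    moreover have "sum (saving_term w a b) {a..<k} \<le> saving w a k"
      using 2 k by (intro saving_left) auto
    ultimately show ?thesis
      using IHl[of T] unfolding path_weight.simps W sav by linarith
  next
    case 3
    then obtain L R where LR: "move_to_lca l = Some L" "move_to_lca r = Some R"
      using shape by auto
    then obtain i where T: "T = Node L i R"
      using Fork.prems(2) by auto
    have "inorder T = map item [first_gap a..<last_gap b]"
      using move_to_lca_segment[OF Fork.prems(1)] Fork.prems(2) k by auto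
    moreover have "distinct \<dots>"
      using inj_item by (auto simp: distinct_map intro: inj_on_subset)
    moreover have sub': "{first_gap a..<last_gap b} \<subseteq> {a..<b}"
      by (auto simp: first_gap_def last_gap_def)
    ultimately have "bst_weight u T = sum w {first_gap a..<last_gap b} + bst_weight u L + bst_weight u R"
      using bst_weight_Node[of L i R u] sum_list_segment[of "first_gap a" "last_gap b" u w] Fork.prems(4)
      unfolding T by auto
    then show ?thesis
      using IHl[OF LR(1)] IHr[OF LR(2)] sub[OF sub'] sav W saving_left[of a k b w] saving_right[of a k b w] 3 k
      by simp
  qed
qed

section \<open>The program and its running time\<close>

text \<open>Each construct gets an unconditional equation for \<open>wp\<close>, so that the simplifier executes programs
  symbolically up to procedure calls.\<close>

definition wp ::
  "program \<Rightarrow> val list \<Rightarrow> memory \<Rightarrow> expr \<Rightarrow> (val \<Rightarrow> memory \<Rightarrow> nat \<Rightarrow> bool) \<Rightarrow> bool" where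
  "wp Pr \<rho> \<mu> e R \<longleftrightarrow> (\<exists>v \<mu>' t. eval Pr \<rho> \<mu> e v \<mu>' t \<and> R v \<mu>' t)"

inductive_cases eval_VarE: "eval Pr \<rho> \<mu> (Var i) v \<mu>' t"
inductive_cases eval_ConstE: "eval Pr \<rho> \<mu> (Const c) v \<mu>' t"
inductive_cases eval_Op1E: "eval Pr \<rho> \<mu> (Op1 f a) v \<mu>' t"
inductive_cases eval_Op2E: "eval Pr \<rho> \<mu> (Op2 f a b) v \<mu>' t"
inductive_cases eval_MkPairE: "eval Pr \<rho> \<mu> (MkPair a b) v \<mu>' t"
inductive_cases eval_FirstE: "eval Pr \<rho> \<mu> (First a) v \<mu>' t"
inductive_cases eval_SecondE: "eval Pr \<rho> \<mu> (Second a) v \<mu>' t"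
inductive_cases eval_LoadE: "eval Pr \<rho> \<mu> (Load a) v \<mu>' t"
inductive_cases eval_StoreE: "eval Pr \<rho> \<mu> (Store a b) v \<mu>' t"
inductive_cases eval_BindE: "eval Pr \<rho> \<mu> (Bind a b) v \<mu>' t"
inductive_cases eval_CondE: "eval Pr \<rho> \<mu> (Cond c a b) v \<mu>' t"
inductive_cases eval_CallE: "eval Pr \<rho> \<mu> (Call f a) v \<mu>' t"

lemma wp_Var: "wp Pr \<rho> \<mu> (Var i) R \<longleftrightarrow> i < length \<rho> \<and> R (\<rho> ! i) \<mu> 1"
  unfolding wp_def by (auto elim!: eval_VarE) (blast intro: eval.Var[simplified])

lemma wp_Const: "wp Pr \<rho> \<mu> (Const c) R \<longleftrightarrow> R (VNum (of_int c)) \<mu> 1"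
  unfolding wp_def by (auto elim!: eval_ConstE) (blast intro: eval.Const[simplified])

lemma wp_Op1:
  "wp Pr \<rho> \<mu> (Op1 f e) R \<longleftrightarrow>
     wp Pr \<rho> \<mu> e (\<lambda>v \<mu>' t. \<exists>x. v = VNum x \<and> R (VNum (unop_sem f x)) \<mu>' (t + 1))"
  unfolding wp_def by (auto elim!: eval_Op1E) (blast intro: eval.Op1[simplified])+

lemma wp_Op2:
  "wp Pr \<rho> \<mu> (Op2 f a b) R \<longleftrightarrow>
     wp Pr \<rho> \<mu> a (\<lambda>v \<mu>' s. \<exists>x. v = VNum x \<and>
       wp Pr \<rho> \<mu>' b (\<lambda>w \<mu>'' t. \<exists>y. w = VNum y \<and>
         R (VNum (binop_sem f x y)) \<mu>'' (s + t + 1)))"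
  unfolding wp_def by (auto elim!: eval_Op2E) (blast intro: eval.Op2[simplified])+

lemma wp_MkPair:
  "wp Pr \<rho> \<mu> (MkPair a b) R \<longleftrightarrow>
     wp Pr \<rho> \<mu> a (\<lambda>v \<mu>' s. wp Pr \<rho> \<mu>' b (\<lambda>w \<mu>'' t. R (VPair v w) \<mu>'' (s + t + 1)))"
  unfolding wp_def by (auto elim!: eval_MkPairE) (blast intro: eval.MkPair[simplified])+

lemma wp_First:
  "wp Pr \<rho> \<mu> (First e) R \<longleftrightarrow> wp Pr \<rho> \<mu> e (\<lambda>u \<mu>' t. \<exists>v w. u = VPair v w \<and> R v \<mu>' (t + 1))"
  unfolding wp_def by (auto elim!: eval_FirstE) (blast intro: eval.First[simplified])+

lemma wp_Second:
  "wp Pr \<rho> \<mu> (Second e) R \<longleftrightarrow> wp Pr \<rho> \<mu> e (\<lambda>u \<mu>' t. \<exists>v w. u = VPair v w \<and> R w \<mu>' (t + 1))"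
  unfolding wp_def by (auto elim!: eval_SecondE) (blast intro: eval.Second[simplified])+

lemma wp_Load:
  "wp Pr \<rho> \<mu> (Load e) R \<longleftrightarrow>
     wp Pr \<rho> \<mu> e (\<lambda>v \<mu>' t. \<exists>a. v = VNum (of_nat a) \<and> R (\<mu>' a) \<mu>' (t + 1))"
  unfolding wp_def by (auto elim!: eval_LoadE) (blast intro: eval.Load[simplified])+

lemma wp_Store:
  "wp Pr \<rho> \<mu> (Store e b) R \<longleftrightarrow>
     wp Pr \<rho> \<mu> e (\<lambda>u \<mu>' s. \<exists>a. u = VNum (of_nat a) \<and>
       wp Pr \<rho> \<mu>' b (\<lambda>v \<mu>'' t. R v (\<mu>''(a := v)) (s + t + 1)))"
  unfolding wp_def by (auto elim!: eval_StoreE) (blast intro: eval.Store[simplified])+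

lemma wp_Bind:
  "wp Pr \<rho> \<mu> (Bind a b) R \<longleftrightarrow>
     wp Pr \<rho> \<mu> a (\<lambda>v \<mu>' s. wp Pr (v # \<rho>) \<mu>' b (\<lambda>w \<mu>'' t. R w \<mu>'' (s + t + 1)))"
  unfolding wp_def by (auto elim!: eval_BindE) (blast intro: eval.Bind[simplified])+

lemma wp_Cond:
  "wp Pr \<rho> \<mu> (Cond c a b) R \<longleftrightarrow>
     wp Pr \<rho> \<mu> c (\<lambda>u \<mu>' s. \<exists>x. u = VNum x \<and>
       wp Pr \<rho> \<mu>' (if x \<noteq> 0 then a else b) (\<lambda>v \<mu>'' t. R v \<mu>'' (s + t + 1)))"
  (is "?L \<longleftrightarrow> ?R")
proof
  assume ?L
  then show ?R
    unfolding wp_def by (fastforce elim!: eval_CondE)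
next
  assume ?R
  then obtain x \<mu>' s v \<mu>'' t where "eval Pr \<rho> \<mu> c (VNum x) \<mu>' s"
    "eval Pr \<rho> \<mu>' (if x \<noteq> 0 then a else b) v \<mu>'' t" "R v \<mu>'' (s + t + 1)"
    unfolding wp_def by blast
  then show ?L
    unfolding wp_def by (cases "x = 0") (auto, (blast intro: eval.Cond_true[simplified] eval.Cond_false[simplified])+)
qed

lemma wp_Call:
  "wp Pr \<rho> \<mu> (Call f e) R \<longleftrightarrow>
     wp Pr \<rho> \<mu> e (\<lambda>v \<mu>' s. \<exists>w \<mu>'' t. runs Pr f v \<mu>' w \<mu>'' t \<and> R w \<mu>'' (s + t + 1))"
  unfolding wp_def runs_def by (auto elim!: eval_CallE) (blast intro: eval.Call[simplified])+

lemmas wp_simps = wp_Var wp_Const wp_Op1 wp_Op2 wp_MkPair wp_First wp_Second wp_Load wp_Store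
  wp_Bind wp_Cond wp_Call

lemma runs_if_wp:
  assumes "f < length Pr" "wp Pr [v] \<mu> (Pr ! f) R"
  shows "\<exists>w \<mu>' t. runs Pr f v \<mu> w \<mu>' t \<and> R w \<mu>' t"
  using assms unfolding wp_def runs_def by blast

text \<open>In the procedures below, a primed name is the unprimed expression shifted under one \<open>Bind\<close>.\<close>

definition center_expr :: "expr \<Rightarrow> expr" where
  "center_expr e = Op2 Add (Load e) (Load (Op2 Add (Const 1) e))"

text \<open>Replaces the weights by prefix sums in place. Cell \<open>j\<close> already holds a
  prefix sum while cell \<open>j + 1\<close> still holds a weight, so \<open>center_expr\<close>
  here yields the next prefix sum.\<close>

definition prefix_proc :: expr where
  "prefix_proc =
     (let j = First (Var 0); m = Second (Var 0); j' = First (Var 1); m' = Second (Var 1) in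
      Cond (Op2 Less j m)
        (Bind (Store (Op2 Add (Const 1) j) (center_expr j))
              (Call 0 (MkPair (Op2 Add (Const 1) j') m')))
        (Const 0))"

text \<open>On prefix sums \<open>center_expr\<close> is twice the center of a leaf's weight
  interval; the target \<open>M\<close> is scaled in the same way.\<close>

definition bisect_proc :: expr where
  "bisect_proc =
     (let lo = First (Second (Var 0)); hi = Second (Second (Var 0));
          M' = First (Var 1); lo' = First (Second (Var 1)); hi' = Second (Second (Var 1));
          mid' = Var 0 in
      Cond (Op2 Less (Op2 Add (Const 1) lo) hi)
        (Bind (Op1 Floor (Op2 Divide (Op2 Add lo hi) (Const 2)))
          (Cond (Op2 Less (center_expr mid') M')
            (Call 1 (MkPair M' (MkPair mid' hi')))
            (Call 1 (MkPair M' (MkPair lo' mid')))))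
        lo)"

text \<open>Both ends move inwards by the same stride \<open>d\<close>, which doubles in every
  round. Once \<open>M\<close> is caught in an end piece, or the two probes meet or cross, bisection
  finishes the search.\<close>

definition gallop_proc :: expr where
  "gallop_proc =
     (let M = First (Var 0); d = First (Second (Var 0));
          lo = First (Second (Second (Var 0))); hi = Second (Second (Second (Var 0)));
          x = Op2 Add lo d; y = Op2 Sub hi d in
      Cond (Op2 Less x y)
        (Cond (Op2 Less (center_expr x) M)
          (Cond (Op2 Less M (center_expr y))
            (Call 2 (MkPair M (MkPair (Op2 Mul (Const 2) d) (MkPair x y))))
            (Call 1 (MkPair M (MkPair y hi))))
          (Call 1 (MkPair M (MkPair lo x))))
        (Call 1 (MkPair M (MkPair lo hi))))"

text \<open>The range from \<open>a\<close> to \<open>c\<close> is inclusive. At a single leaf,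
  halving and doubling its position tests the parity that separates gaps from keys.\<close>

definition build_proc :: expr where
  "build_proc =
     (let a = First (Var 0); c = Second (Var 0); a' = First (Var 1); c' = Second (Var 1) in
      Cond (Op2 Less a c)
        (Bind (Call 2 (MkPair (Op2 Add (Load a) (Load (Op2 Add (Const 1) c)))
                        (MkPair (Const 1) (MkPair a c))))
          (MkPair (Const 2)
            (MkPair (Call 3 (MkPair a' (Var 0))) (Call 3 (MkPair (Op2 Add (Const 1) (Var 0)) c')))))
        (Bind (Op1 Floor (Op2 Divide a (Const 2)))
          (Cond (Op2 Equal (Op2 Add (Var 0) (Var 0)) a')
            (MkPair (Const 0) (Var 0))
            (MkPair (Const 1) (Op2 Add (Const 1) (Var 0))))))"

definition construct_proc :: expr where
  "construct_proc =
     (let m = Op2 Add (Const 1) (Op2 Add (Var 0) (Var 0)) in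
      Bind (Call 0 (MkPair (Const 0) m)) (Call 3 (MkPair (Const 0) (Op2 Add (Var 1) (Var 1)))))"

text \<open>Next to the contracted tree the index of its first gap is returned, with -1 marking the
  empty tree. The label of a surviving node is the index of the first gap on its right, so no search
  for common ancestors is needed. A gap leaf has the same representation in both kinds of tree and
  is reused.\<close>

definition contract_proc :: expr where
  "contract_proc =
     (let tag = First (Var 0); L = Var 1; R = Var 0 in
      Cond (Op2 Equal tag (Const 2))
        (Bind (Call 5 (First (Second (Var 0))))
          (Bind (Call 5 (Second (Second (Var 1))))
            (Cond (Op2 Less (First L) (Const 0)) R
              (Cond (Op2 Less (First R) (Const 0)) L
                (MkPair (First L)
                  (MkPair (Const 1) (MkPair (First R) (MkPair (Second L) (Second R)))))))))
        (Cond (Op2 Equal tag (Const 1))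
          (MkPair (Const (- 1)) (Const 0))
          (MkPair (Second (Var 0)) (Var 0))))"

definition move_proc :: expr where
  "move_proc = Second (Call 5 (Var 0))"

definition tree_program :: program where
  "tree_program = [prefix_proc, bisect_proc, gallop_proc, build_proc, construct_proc,
     contract_proc, move_proc]"

lemma length_tree_program: "length tree_program = 7"
  by (simp add: tree_program_def)

lemma tree_program_nth:
  "tree_program ! 0 = prefix_proc" "tree_program ! 1 = bisect_proc"
  "tree_program ! 2 = gallop_proc" "tree_program ! 3 = build_proc"
  "tree_program ! 4 = construct_proc" "tree_program ! 5 = contract_proc"
  "tree_program ! 6 = move_proc"
  by (simp_all add: tree_program_def)

text \<open>A memory access demands a natural number equal to the computed real address; these
  equations solve for it.\<close>

lemma real_eq_iffs:
  "1 + real x = real a \<longleftrightarrow> a = Suc x"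
  "real x + real y = real a \<longleftrightarrow> a = x + y"
  "1 + (real x + real y) = real a \<longleftrightarrow> a = Suc (x + y)"
  by auto

lemmas program_simps = length_tree_program tree_program_nth[simplified] Let_def wp_simps center_expr_def
  prefix_proc_def bisect_proc_def gallop_proc_def build_proc_def construct_proc_def
  contract_proc_def move_proc_def real_eq_iffs

section \<open>Correctness and running time of the tree construction\<close>

lemma prefix_runs:
  assumes "j \<le> m" "\<And>x. x \<le> j \<Longrightarrow> \<mu> x = VNum (\<Sum>y<x. w y)"
    "\<And>x. j \<le> x \<Longrightarrow> x < m \<Longrightarrow> \<mu> (Suc x) = VNum (w x)"
  shows "\<exists>v \<mu>' t. runs tree_program 0 (VPair (VNum (real j)) (VNum (real m))) \<mu> v \<mu>' t \<and>
     (\<forall>x\<le>m. \<mu>' x = VNum (\<Sum>y<x. w y)) \<and> t \<le> 40 * (m - j) + 40"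
  using assms
proof (induction "m - j" arbitrary: j \<mu>)
  case 0
  then show ?case
    by (intro runs_if_wp) (simp_all add: program_simps)
next
  case (Suc k)
  let ?\<mu> = "\<mu>(Suc j := VNum (\<Sum>y<Suc j. w y))"
  have "j < m" using Suc.hyps by simp
  have "\<exists>v \<mu>' t. runs tree_program 0 (VPair (VNum (real (Suc j))) (VNum (real m))) ?\<mu> v \<mu>' t \<and>
     (\<forall>x\<le>m. \<mu>' x = VNum (\<Sum>y<x. w y)) \<and> t \<le> 40 * (m - Suc j) + 40"
    by (rule Suc.hyps(1)) (use Suc in \<open>auto simp: le_Suc_eq\<close>)
  then obtain v \<mu>' t where
    "runs tree_program 0 (VPair (VNum (real (Suc j))) (VNum (real m))) ?\<mu> v \<mu>' t"
    "\<forall>x\<le>m. \<mu>' x = VNum (\<Sum>y<x. w y)" "t \<le> 40 * (m - Suc j) + 40"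
    by blast
  then show ?case
    using Suc.prems \<open>j < m\<close> Suc.hyps(2)
    apply (intro runs_if_wp)
    apply (simp add: program_simps)
    apply (simp add: program_simps)
    apply (intro exI conjI)
    apply assumption
    apply simp_all
    done
qed

lemma runs_nat_if_wp:
  assumes "f < length Pr"
    "wp Pr [v] \<mu> (Pr ! f) (\<lambda>w \<mu>' t. \<exists>k::nat. w = VNum (real k) \<and> \<mu>' = \<mu> \<and> R k t)"
  shows "\<exists>k t. runs Pr f v \<mu> (VNum (real k)) \<mu> t \<and> R k t"
  using runs_if_wp[OF assms] by blast

lemma runs_intro:
  "runs Pr f v \<mu> w \<mu>' t \<Longrightarrow> R w \<mu>' t \<Longrightarrow> \<exists>w \<mu>' t. runs Pr f v \<mu> w \<mu>' t \<and> R w \<mu>' t"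
  by blast

lemma floor_half: "\<lfloor>(real a + real b) / 2\<rfloor> = int ((a + b) div 2)"
  using floor_divide_of_nat_eq[of "a + b" 2] by simp

text \<open>With \<open>M = S a + S b\<close>, the centers of the leaves \<open>k\<close> and \<open>Suc k\<close> enclose the midpoint of the segment
  (all scaled by 2), so splitting between them is balanced up to the weight of one of the two.\<close>

definition center_split :: "(nat \<Rightarrow> real) \<Rightarrow> real \<Rightarrow> nat \<Rightarrow> bool" where
  "center_split S M k \<longleftrightarrow> S k + S (Suc k) \<le> M \<and> M \<le> S (Suc k) + S (Suc (Suc k))"

text \<open>\<open>M\<close> stays between the centers of \<open>lo\<close> and \<open>hi\<close>;
  once these are neighbours, this invariant is \<open>center_split\<close>.\<close>

lemma bisect_runs:
  assumes "lo < hi" "hi - lo \<le> 2 ^ i" "\<And>x. x \<le> Suc hi \<Longrightarrow> \<mu> x = VNum (S x)"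
    "S lo + S (Suc lo) \<le> M" "M \<le> S hi + S (Suc hi)"
  shows "\<exists>k t. runs tree_program 1 (VPair (VNum M) (VPair (VNum (real lo)) (VNum (real hi)))) \<mu>
       (VNum (real k)) \<mu> t \<and> lo \<le> k \<and> k < hi \<and> center_split S M k \<and> t \<le> 70 * (i + 1)"
  using assms
proof (induction i arbitrary: lo hi)
  case 0
  then have "hi = Suc lo" by simp
  with 0 show ?case
    by (intro runs_nat_if_wp) (simp_all add: program_simps center_split_def)
next
  case (Suc i)
  define mid where "mid = (lo + hi) div 2"
  note program_simps = program_simps floor_half mid_def[symmetric]
  consider "hi = Suc lo" | "Suc lo < hi" "S mid + S (Suc mid) < M"
    | "Suc lo < hi" "M \<le> S mid + S (Suc mid)"
    using Suc.prems by linarith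
  then show ?case
  proof cases
    case 1
    with Suc.prems show ?thesis
      by (intro runs_nat_if_wp) (simp_all add: program_simps center_split_def)
  next
    case 2
    have "\<exists>k t. runs tree_program 1 (VPair (VNum M) (VPair (VNum (real mid)) (VNum (real hi)))) \<mu>
       (VNum (real k)) \<mu> t \<and> mid \<le> k \<and> k < hi \<and> center_split S M k \<and> t \<le> 70 * (i + 1)"
      by (rule Suc.IH) (use 2 Suc.prems in \<open>auto simp: mid_def\<close>)
    then obtain k t where k: "runs tree_program 1
        (VPair (VNum M) (VPair (VNum (real mid)) (VNum (real hi)))) \<mu> (VNum (real k)) \<mu> t"
      "mid \<le> k" "k < hi" "center_split S M k" "t \<le> 70 * (i + 1)"
      by blast
    moreover have "\<mu> mid = VNum (S mid)" "\<mu> (Suc mid) = VNum (S (Suc mid))" "lo \<le> mid"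
      using 2 Suc.prems by (auto simp: mid_def)
    ultimately show ?thesis
      using 2
      by (intro runs_nat_if_wp) (simp_all add: program_simps, intro exI conjI, assumption, simp_all)
  next
    case 3
    have "\<exists>k t. runs tree_program 1 (VPair (VNum M) (VPair (VNum (real lo)) (VNum (real mid)))) \<mu>
       (VNum (real k)) \<mu> t \<and> lo \<le> k \<and> k < mid \<and> center_split S M k \<and> t \<le> 70 * (i + 1)"
      by (rule Suc.IH) (use 3 Suc.prems in \<open>auto simp: mid_def\<close>)
    then obtain k t where k: "runs tree_program 1
        (VPair (VNum M) (VPair (VNum (real lo)) (VNum (real mid)))) \<mu> (VNum (real k)) \<mu> t"
      "lo \<le> k" "k < mid" "center_split S M k" "t \<le> 70 * (i + 1)"
      by blast
    moreover have "\<mu> mid = VNum (S mid)" "\<mu> (Suc mid) = VNum (S (Suc mid))" "mid \<le> hi"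
      using 3 Suc.prems by (auto simp: mid_def)
    ultimately show ?thesis
      using 3
      by (intro runs_nat_if_wp) (simp_all add: program_simps, intro exI conjI, assumption, simp_all)
  qed
qed

text \<open>Step \<open>j\<close> of a search that started with stride \<open>2 ^ 0\<close> has excluded about \<open>2 ^ j\<close> leaves at both ends,
  which bounds \<open>j\<close> by the logarithm of the smaller part.\<close>

definition gallop_time :: "nat \<Rightarrow> nat \<Rightarrow> nat \<Rightarrow> nat \<Rightarrow> nat \<Rightarrow> bool" where
  "gallop_time lo hi i k t \<longleftrightarrow>
     (\<exists>j\<ge>i. lo + 2 ^ j \<le> k + 2 ^ i \<and> k + 2 ^ j < hi + 2 ^ i \<and> t + 150 * i \<le> 250 * (j + 2))"

text \<open>The induction is on \<open>hi - lo\<close> because the stride grows while the interval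
  shrinks. The cases are the four branches of the procedure; only the last one recurses.\<close>

lemma gallop_runs:
  assumes "lo < hi" "\<And>x. x \<le> Suc hi \<Longrightarrow> \<mu> x = VNum (S x)"
    "S lo + S (Suc lo) \<le> M" "M \<le> S hi + S (Suc hi)"
  shows "\<exists>k t. runs tree_program 2
       (VPair (VNum M) (VPair (VNum (2 ^ i)) (VPair (VNum (real lo)) (VNum (real hi))))) \<mu>
       (VNum (real k)) \<mu> t \<and> center_split S M k \<and> gallop_time lo hi i k t"
  using assms
proof (induction "hi - lo" arbitrary: lo hi i rule: less_induct)
  case less
  define d :: nat where "d = 2 ^ i"
  have d: "2 ^ i = real d" "d > 0" by (simp_all add: d_def)
  note program_simps = program_simps d(1)
  consider "hi \<le> lo + 2 * d"
    | "lo + 2 * d < hi" "M \<le> S (lo + d) + S (Suc (lo + d))"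
    | "lo + 2 * d < hi" "S (lo + d) + S (Suc (lo + d)) < M" "S (hi - d) + S (Suc (hi - d)) \<le> M"
    | "lo + 2 * d < hi" "S (lo + d) + S (Suc (lo + d)) < M" "M < S (hi - d) + S (Suc (hi - d))"
    by linarith
  then show ?case
  proof cases
    case 1
    have "\<exists>k t. runs tree_program 1 (VPair (VNum M) (VPair (VNum (real lo)) (VNum (real hi)))) \<mu>
       (VNum (real k)) \<mu> t \<and> lo \<le> k \<and> k < hi \<and> center_split S M k \<and> t \<le> 70 * (Suc i + 1)"
      by (rule bisect_runs) (use 1 less.prems in \<open>auto simp: d_def\<close>)
    then obtain k t where k: "runs tree_program 1
        (VPair (VNum M) (VPair (VNum (real lo)) (VNum (real hi)))) \<mu> (VNum (real k)) \<mu> t"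
      "lo \<le> k" "k < hi" "center_split S M k" "t \<le> 70 * (Suc i + 1)"
      by blast
    \<comment> \<open>This round is the last, so \<open>j = i\<close>. The bisection costs at most
      \<open>70 * (i + 2)\<close>, each round up to this one is charged 150, and the total stays
      below \<open>250 * (i + 2)\<close>.\<close>
    have gt: "gallop_time lo hi i k t'" if "t' \<le> t + 150" for t'
      unfolding gallop_time_def using k that by (intro exI[of _ i]) auto
    from k 1 show ?thesis
      apply (intro runs_nat_if_wp)
      apply (simp add: program_simps)
      apply (simp add: program_simps)
      apply (intro exI conjI)
      apply assumption
      apply (assumption | rule refl | (rule gt, simp))+
      done
  next
    case 2
    have "\<exists>k t. runs tree_program 1 (VPair (VNum M) (VPair (VNum (real lo)) (VNum (real (lo + d))))) \<mu>
       (VNum (real k)) \<mu> t \<and> lo \<le> k \<and> k < lo + d \<and> center_split S M k \<and> t \<le> 70 * (i + 1)"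
      by (rule bisect_runs) (use 2 d less.prems in \<open>auto simp: d_def\<close>)
    then obtain k t where k: "runs tree_program 1
        (VPair (VNum M) (VPair (VNum (real lo)) (VNum (real (lo + d))))) \<mu> (VNum (real k)) \<mu> t"
      "lo \<le> k" "k < lo + d" "center_split S M k" "t \<le> 70 * (i + 1)"
      by blast
    have gt: "gallop_time lo hi i k t'" if "t' \<le> t + 150" for t'
      unfolding gallop_time_def using k 2 that by (intro exI[of _ i]) auto
    note k
    moreover have "\<mu> (lo + d) = VNum (S (lo + d))" "\<mu> (Suc (lo + d)) = VNum (S (Suc (lo + d)))"
      using 2 less.prems by auto
    ultimately show ?thesis
      using 2
      apply (intro runs_nat_if_wp)
      apply (simp add: program_simps)
      apply (simp add: program_simps)
      apply (intro exI conjI)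
      apply assumption
      apply (assumption | rule refl | (rule gt, simp))+
      done
  next
    case 3
    then obtain y where y: "hi = y + d" 
      using le_add_diff_inverse2[of d hi] by (metis add.commute add_lessD1 less_imp_le mult_2 trans_le_add2 add_leD2)
    have "\<exists>k t. runs tree_program 1 (VPair (VNum M) (VPair (VNum (real y)) (VNum (real hi)))) \<mu>
       (VNum (real k)) \<mu> t \<and> y \<le> k \<and> k < hi \<and> center_split S M k \<and> t \<le> 70 * (i + 1)"
      by (rule bisect_runs) (use 3 y d less.prems in \<open>auto simp: d_def\<close>)
    then obtain k t where k: "runs tree_program 1
        (VPair (VNum M) (VPair (VNum (real y)) (VNum (real hi)))) \<mu> (VNum (real k)) \<mu> t"
      "y \<le> k" "k < hi" "center_split S M k" "t \<le> 70 * (i + 1)"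
      by blast
    have gt: "gallop_time lo hi i k t'" if "t' \<le> t + 150" for t'
      unfolding gallop_time_def using k 3 y that by (intro exI[of _ i]) auto
    note k
    moreover have "\<mu> (lo + d) = VNum (S (lo + d))" "\<mu> (Suc (lo + d)) = VNum (S (Suc (lo + d)))"
      "\<mu> y = VNum (S y)" "\<mu> (Suc y) = VNum (S (Suc y))"
      using 3 y less.prems by auto
    ultimately show ?thesis
      using 3 y
      apply (intro runs_nat_if_wp)
      apply (simp add: program_simps)
      apply (simp add: program_simps)
      apply (intro exI conjI)
      apply assumption
      apply (assumption | rule refl | (rule gt[unfolded y], simp))+
      done
  next
    case 4
    then obtain y where y: "hi = y + d" 
      using le_add_diff_inverse2[of d hi] by (metis add.commute add_lessD1 less_imp_le mult_2 trans_le_add2 add_leD2)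
    have "\<exists>k t. runs tree_program 2
       (VPair (VNum M) (VPair (VNum (2 ^ Suc i)) (VPair (VNum (real (lo + d))) (VNum (real y))))) \<mu>
       (VNum (real k)) \<mu> t \<and> center_split S M k \<and> gallop_time (lo + d) y (Suc i) k t"
      by (rule less.hyps) (use 4 y d less.prems in auto)
    then obtain k t j where k: "runs tree_program 2
       (VPair (VNum M) (VPair (VNum (2 ^ Suc i)) (VPair (VNum (real (lo + d))) (VNum (real y))))) \<mu>
       (VNum (real k)) \<mu> t" "center_split S M k" and j: "j \<ge> Suc i"
       "(lo + d) + 2 ^ j \<le> k + 2 ^ Suc i" "k + 2 ^ j < y + 2 ^ Suc i"
       "t + 150 * Suc i \<le> 250 * (j + 2)"
      unfolding gallop_time_def by blast
    \<comment> \<open>The same \<open>j\<close> serves: moving both ends by \<open>d = 2 ^ i\<close>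
      exactly offsets the change from \<open>2 ^ i\<close> to \<open>2 ^ Suc i\<close>.\<close>
    have gt: "gallop_time lo hi i k t'" if "t' \<le> t + 150" for t'
      unfolding gallop_time_def using j y that by (intro exI[of _ j]) (auto simp: d_def)
    note k
    moreover have "\<mu> (lo + d) = VNum (S (lo + d))" "\<mu> (Suc (lo + d)) = VNum (S (Suc (lo + d)))"
      "\<mu> y = VNum (S y)" "\<mu> (Suc y) = VNum (S (Suc y))"
      using 4 y less.prems by auto
    ultimately show ?thesis
      using 4 y
      apply (intro runs_nat_if_wp)
      apply (simp add: program_simps)
      apply (simp add: program_simps)
      apply (intro exI conjI)
      apply assumption
      apply (assumption | rule refl | (rule gt[unfolded y], simp))+
      done
  qed
qed

text \<open>The subtracted logarithm is the potential that pays for searches: the larger of the two parts loses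
  at most 1 of it, and the smaller part releases at least \<open>j\<close>.\<close>

lemma log_split_step:
  fixes C D :: real
  assumes "0 \<le> C" "1 \<le> m" "1 \<le> m'" "real j \<le> log 2 m" "real j \<le> log 2 m'"
    "t \<le> D * m - C * log 2 m - 2 * C" "t' \<le> D * m' - C * log 2 m' - 2 * C"
    "s \<le> C * (real j + 1)"
  shows "t + t' + s \<le> D * (m + m') - C * log 2 (m + m') - 2 * C"
proof -
  have "log 2 (m + m') \<le> log 2 (2 * max m m')"
    using assms by (subst log_le_cancel_iff) auto
  also have "\<dots> = 1 + log 2 (max m m')"
    using assms by (subst log_mult_pos) auto
  also have "\<dots> + real j \<le> 1 + log 2 m + log 2 m'"
    using assms by (simp add: max_def)
  finally have "C * (log 2 (m + m') + real j) \<le> C * (1 + log 2 m + log 2 m')"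
    using assms by (intro mult_left_mono) auto
  with assms show ?thesis
    by (simp add: algebra_simps)
qed

text \<open>The bound is the one in \<open>log_split_step\<close> with \<open>C = 600\<close> and
  \<open>D = 1300\<close>. For a single leaf it allows 1300 - 1200 = 100 steps. At a fork, the
  search time \<open>250 * (j + 2)\<close> and an overhead of 100 are together at most
  \<open>600 * (j + 1)\<close>.\<close>

lemma build_runs:
  assumes "a \<le> c" "\<And>x. x \<le> Suc c \<Longrightarrow> \<mu> x = VNum (sum w {..<x})"
    "\<And>x. x \<le> c \<Longrightarrow> 0 \<le> w x"
  shows "\<exists>A t. runs tree_program 3 (VPair (VNum (real a)) (VNum (real c))) \<mu> (code_tree_val A) \<mu> t \<and>
     balanced w a (Suc c) A \<and>
     real t \<le> 1300 * (real c + 1 - real a) - 600 * log 2 (real c + 1 - real a) - 1200"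
  using assms
proof (induction "c - a" arbitrary: a c rule: less_induct)
  case less
  have wp: ?case if "wp tree_program [VPair (VNum (real a)) (VNum (real c))] \<mu> build_proc
      (\<lambda>v \<mu>' t. \<exists>A. v = code_tree_val A \<and> \<mu>' = \<mu> \<and> balanced w a (Suc c) A \<and>
     real t \<le> 1300 * (real c + 1 - real a) - 600 * log 2 (real c + 1 - real a) - 1200)"
    using runs_if_wp[of 3 tree_program _ \<mu>] that 
    by (fastforce simp: length_tree_program tree_program_nth)
  show ?case
  proof (cases "a = c")
    case True
    have fl: "\<lfloor>real c / 2\<rfloor> = int (c div 2)"
      using floor_half[of c 0] by simp
    have "balanced w c (Suc c) (Tip (item c))"
      by (rule balanced.Tip)
    moreover have "real (c div 2) + real (c div 2) = real c \<longleftrightarrow> even c"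
      unfolding of_nat_add[symmetric] of_nat_eq_iff by presburger
    ultimately show ?thesis
      using True by (intro wp) (auto simp: program_simps fl item_def intro!: exI[of _ "Tip (item c)"])
  next
    case False
    with less.prems(1) have "a < c" by simp
    define S where "S x = sum w {..<x}" for x
    define M where "M = S a + S (Suc c)"
    have S_Suc: "S (Suc x) = S x + w x" for x
      by (simp add: S_def)
    have S_mono: "S x \<le> S y" if "x \<le> y" "y \<le> Suc c" for x y
      unfolding S_def using that less.prems(3) by (intro sum_mono2) auto
    have mu: "\<mu> x = VNum (S x)" if "x \<le> Suc c" for x
      using less.prems(2) that by (simp add: S_def)
    have "\<exists>k t. runs tree_program 2
       (VPair (VNum M) (VPair (VNum (2 ^ 0)) (VPair (VNum (real a)) (VNum (real c))))) \<mu>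
       (VNum (real k)) \<mu> t \<and> center_split S M k \<and> gallop_time a c 0 k t"
      using \<open>a < c\<close> mu S_mono[of "Suc a" "Suc c"] S_mono[of a c]
      by (intro gallop_runs) (auto simp: M_def)
    then obtain k t j where k: "runs tree_program 2
       (VPair (VNum M) (VPair (VNum 1) (VPair (VNum (real a)) (VNum (real c))))) \<mu>
       (VNum (real k)) \<mu> t" "center_split S M k"
      and j: "a + 2 ^ j \<le> Suc k" "k + 2 ^ j \<le> c" "t \<le> 250 * (j + 2)"
      by (auto simp: gallop_time_def)
    have "(2::nat) ^ j > 0" by simp
    with j have kac: "a \<le> k" "k < c" by linarith+
    obtain l tl where l: "runs tree_program 3 (VPair (VNum (real a)) (VNum (real k))) \<mu> (code_tree_val l) \<mu> tl"
      "balanced w a (Suc k) l"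
      "real tl \<le> 1300 * (real k + 1 - real a) - 600 * log 2 (real k + 1 - real a) - 1200"
      using less.hyps[OF diff_less_mono[OF kac(2,1)] kac(1)] less.prems kac by (meson le_trans less_imp_le_nat Suc_le_mono)
    obtain r tr where r: "runs tree_program 3 (VPair (VNum (real (Suc k))) (VNum (real c))) \<mu> (code_tree_val r) \<mu> tr"
      "balanced w (Suc k) (Suc c) r"
      "real tr \<le> 1300 * (real c + 1 - real (Suc k)) - 600 * log 2 (real c + 1 - real (Suc k)) - 1200"
      using less.hyps[of c "Suc k"] less.prems kac diff_less_mono2[of a "Suc k" c] by auto
    have sum_S: "sum w {x..<y} = S y - S x" if "x \<le> y" for x y
      using that sum.atLeastLessThan_concat[of 0 x y w] by (simp add: S_def atLeast0LessThan)
    have bal: "balanced w a (Suc c) (Fork l r)"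
    proof (rule balanced.Fork[OF l(2) r(2)])
      \<comment> \<open>The difference of the two sides is \<open>2 * S (Suc k) - M\<close>; the two
        inequalities of \<open>center_split\<close> place it between \<open>- w (Suc k)\<close> and
        \<open>w k\<close>.\<close>
      show "\<bar>sum w {a..<Suc k} - sum w {Suc k..<Suc c}\<bar> \<le> max (w k) (w (Suc k))"
        unfolding sum_S[OF le_SucI[OF kac(1)]] sum_S[OF Suc_leI[OF less_SucI[OF kac(2)]]]
        by (rule abs_leI) (use k(2) S_Suc[of k] S_Suc[of "Suc k"] max.cobounded1[of "w k" "w (Suc k)"]
          max.cobounded2[of "w (Suc k)" "w k"] in \<open>unfold center_split_def M_def, linarith\<close>)+
    qed
    \<comment> \<open>Starting from stride 1, \<open>gallop_time\<close> leaves at least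
      \<open>2 ^ j\<close> leaves in each part.\<close>
    have log_j: "real j \<le> log 2 (real k + 1 - real a)" "real j \<le> log 2 (real c + 1 - real (Suc k))"
    proof -
      have *: "real j \<le> log 2 (real x)" if "2 ^ j \<le> x" for x :: nat
      proof -
        have "real (2 ^ j) \<le> real x" using that by (simp only: of_nat_le_iff)
        moreover have "x > 0" using that by (cases x) auto
        ultimately show ?thesis by (simp add: le_log_iff powr_realpow)
      qed
      show "real j \<le> log 2 (real k + 1 - real a)" 
        using *[of "Suc k - a"] j kac by (simp add: of_nat_diff algebra_simps)
      show "real j \<le> log 2 (real c + 1 - real (Suc k))"
        using *[of "c - k"] j kac by (simp add: of_nat_diff algebra_simps)
    qed
    have "real tl + real tr + real (t + 100) \<le>
      1300 * ((real k + 1 - real a) + (real c + 1 - real (Suc k)))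
      - 600 * log 2 ((real k + 1 - real a) + (real c + 1 - real (Suc k))) - 2 * 600"
      by (rule log_split_step[OF _ _ _ log_j]) (use j kac l(3) r(3) in auto)
    then have time: "real t' \<le> 1300 * (real c + 1 - real a) - 600 * log 2 (real c + 1 - real a) - 1200"
      if "t' \<le> tl + tr + t + 100" for t'
      using j kac that by (simp add: algebra_simps)
    show ?thesis
      using \<open>a < c\<close>
      apply (intro wp)
      apply (simp add: program_simps mu)
      apply (rule runs_intro[OF k(1)[unfolded M_def]])
      apply simp
      apply (rule runs_intro[OF l(1)])
      apply (rule runs_intro[OF r(1)[unfolded of_nat_Suc]])
      apply (rule exI[of _ "Fork l r"])
      apply (use bal time[of "tl + tr + t + 40"] in simp)
      done
  qed
qed

section \<open>Contraction to a search tree in linear time\<close>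

definition contraction_val :: "nat \<Rightarrow> bst option \<Rightarrow> val" where
  "contraction_val i T =
     (case T of None \<Rightarrow> VPair (VNum (- 1)) (VNum 0) | Some T \<Rightarrow> VPair (VNum (real i)) (bst_val T))"

text \<open>The first gap at or after position \<open>a\<close> is \<open>P (Suc a div 2)\<close>;
  for the right part this index is the label found in \<open>label_Fork_segment\<close>. Each
  subtree keeps a credit of 100, so that of the two credits at a fork one pays for the fork and the
  other is passed on.\<close>

lemma contract_runs:
  assumes "leaves A = map item [a..<b]"
  shows "\<exists>t. runs tree_program 5 (code_tree_val A) \<mu> (contraction_val (Suc a div 2) (move_to_lca A)) \<mu> t \<and>
     t + 100 \<le> 200 * (b - a)"
  using assms
proof (induction A arbitrary: a b)
  case (Tip x)
  then have "b - a = 1"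
    by (metis One_nat_def leaves.simps(1) length_Cons length_map length_upt list.size(3))
  then have b: "b = Suc a" by simp
  with Tip have x: "x = item a" by simp
  have "\<exists>v \<mu>' t. runs tree_program 5 (code_tree_val (Tip x)) \<mu> v \<mu>' t \<and>
     v = contraction_val (Suc a div 2) (move_to_lca (Tip x)) \<and> \<mu>' = \<mu> \<and> t + 100 \<le> 200 * (b - a)"
    by (rule runs_if_wp) (auto simp: program_simps x b item_def contraction_val_def)
  then show ?case by blast
next
  case (Fork l r)
  obtain k where k: "a < k" "k < b" "leaves l = map item [a..<k]" "leaves r = map item [k..<b]"
    using leaves_Fork_segment[OF Fork.prems] by blast
  obtain tl where l: "runs tree_program 5 (code_tree_val l) \<mu> (contraction_val (Suc a div 2) (move_to_lca l)) \<mu> tl"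
    "tl + 100 \<le> 200 * (k - a)"
    using Fork.IH(1)[OF k(3)] by blast
  obtain tr where r: "runs tree_program 5 (code_tree_val r) \<mu> (contraction_val (Suc k div 2) (move_to_lca r)) \<mu> tr"
    "tr + 100 \<le> 200 * (b - k)"
    using Fork.IH(2)[OF k(4)] by blast
  have time: "t' + 100 \<le> 200 * (b - a)" if "t' \<le> tl + tr + 100" for t'
    using that l(2) r(2) k by linarith
  note shape = move_to_lca_segment[OF k(3)] move_to_lca_segment[OF k(4)]
  have wp: ?case if "wp tree_program [code_tree_val (Fork l r)] \<mu> contract_proc
      (\<lambda>v \<mu>' t. v = contraction_val (Suc a div 2) (move_to_lca (Fork l r)) \<and> \<mu>' = \<mu> \<and>
        t + 100 \<le> 200 * (b - a))"
    using runs_if_wp[of 5 tree_program _ \<mu>] that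
    by (fastforce simp: length_tree_program tree_program_nth)
  consider "odd a" "k = Suc a" | "odd k" "b = Suc k"
    | "\<not> (odd a \<and> k = Suc a)" "\<not> (odd k \<and> b = Suc k)"
    by blast
  then show ?case
  proof cases
    case 1
    then obtain R where LR: "move_to_lca l = None" "move_to_lca r = Some R"
      using shape k by auto
    have i: "Suc k div 2 = Suc a div 2"
      using 1 by presburger
    show ?thesis
      apply (rule wp)
      apply (simp add: program_simps)
      apply (rule runs_intro[OF l(1)])
      apply (simp add: LR i contraction_val_def)
      apply (rule runs_intro[OF r(1)])
      apply (simp add: LR i contraction_val_def)
      apply (rule exI[of _ "- 1"])
      apply (use time[of "tl + tr + 21"] in simp)
      done
  next
    case 2
    then obtain L where LR: "move_to_lca l = Some L" "move_to_lca r = None"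
      using shape k by (auto split: if_splits)
    show ?thesis
      apply (rule wp)
      apply (simp add: program_simps)
      apply (rule runs_intro[OF l(1)])
      apply (simp add: LR contraction_val_def)
      apply (rule runs_intro[OF r(1)])
      apply (simp add: LR contraction_val_def)
      apply (rule exI[of _ "real (Suc a div 2)"])
      apply simp
      apply (rule exI[of _ "- 1"])
      apply (use time[of "tl + tr + 26"] in simp)
      done
  next
    case 3
    then obtain L R where LR: "move_to_lca l = Some L" "move_to_lca r = Some R"
      using shape by auto
    have moved: "move_to_lca (Fork l r) = Some (Node L (Suc k div 2) R)"
      by (simp only: move_to_lca.simps LR label_Fork_segment[OF k(3,4,1,2) 3] prod.case option.case)
    show ?thesis
      apply (rule wp)
      apply (simp add: program_simps moved del: move_to_lca.simps)
      apply (rule runs_intro[OF l(1)])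
      apply (simp add: LR contraction_val_def)
      apply (rule runs_intro[OF r(1)])
      apply (simp add: LR contraction_val_def)
      apply (rule exI[of _ "real (Suc a div 2)"])
      apply simp
      apply (rule exI[of _ "real (Suc k div 2)"])
      apply (use time[of "tl + tr + 38"] in simp)
      done
  qed
qed

section \<open>The cost bound\<close>

lemma sum_interleaved:
  fixes f :: "nat \<Rightarrow> 'a::comm_monoid_add"
  shows "(\<Sum>x=0..<2 * n + 1. f x) = (\<Sum>i=1..n. f (2 * i - 1)) + (\<Sum>i=0..n. f (2 * i))"
  by (induction n) (simp_all add: ac_simps)

lemma items_in_order_eq: "items_in_order n = map item [0..<2 * n + 1]"
proof -
  have "concat (map (\<lambda>i. [Q i, P i]) [1..<n + 1]) = map item [1..<2 * n + 1]"
    by (induction n) (simp_all add: item_def)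
  then show ?thesis
    by (simp add: items_in_order_def upt_conv_Cons item_def del: upt_Suc)
qed

lemma cost_eq_bst_weight:
  assumes "search_tree n T" "\<And>x. x < 2 * n + 1 \<Longrightarrow> u (item x) = sigma p q (Suc x)"
  shows "cost n p q T = bst_weight u T"
proof -
  have "bst_weight u T = (\<Sum>x=0..<2 * n + 1. sigma p q (Suc x) * real (level T (item x)))"
    using assms unfolding search_tree_def items_in_order_eq bst_weight_def
    by (simp only: sum_list_segment)
  also have "\<dots> = cost n p q T"
  proof -
    have "Suc ((2 * i - Suc 0) div 2) = i" if "Suc 0 \<le> i" for i
      using that by presburger
    then show ?thesis
      unfolding sum_interleaved cost_def
      by (intro arg_cong2[where f = "(+)"] sum.cong) (auto simp: sigma_def item_def)
  qed
  finally show ?thesis by simp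
qed

lemma sum_min_neighbours:
  fixes p q :: "nat \<Rightarrow> real"
  assumes "1 \<le> n"
  shows "(\<Sum>x=0..<2 * n. min (sigma p q (Suc x)) (sigma p q (Suc (Suc x)))) =
    (\<Sum>i=0..n-1. min (p i) (q (i+1))) + (\<Sum>i=1..n. min (q i) (p i))"
proof -
  have "(\<Sum>x=0..<2 * n. min (sigma p q (Suc x)) (sigma p q (Suc (Suc x)))) =
    (\<Sum>i=0..<n. min (p i) (q (i+1))) + (\<Sum>i=1..n. min (q i) (p i))"
    by (induction n) (simp_all add: sigma_def)
  moreover have "{0..n-1} = {0..<n}" using assms by auto
  ultimately show ?thesis by simp
qed

lemma saving_full:
  assumes "1 \<le> n"
  shows "saving (\<lambda>x. sigma p q (Suc x)) 0 (2 * n + 1) =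
    (\<Sum>i=1..n. q i) + (\<Sum>i=0..n-1. min (p i) (p (i+1)))"
proof -
  let ?s = "saving_term (\<lambda>x. sigma p q (Suc x)) 0 (2 * n + 1)"
  have "?s (2 * i - 1) = q i + min (p (i - 1)) (p i)" if "i \<in> {1..n}" for i
    using that by (cases i) (auto simp: saving_term_def sigma_def)
  moreover have "?s (2 * i) = 0" for i
    by (simp add: saving_term_def)
  ultimately have "saving (\<lambda>x. sigma p q (Suc x)) 0 (2 * n + 1) =
    (\<Sum>i=1..n. q i + min (p (i - 1)) (p i))"
    using assms sum_interleaved[of ?s n] by (simp add: saving_def)
  also have "\<dots> = (\<Sum>i=1..n. q i) + (\<Sum>i=1..n. min (p (i - 1)) (p i))"
    by (rule sum.distrib)
  also have "(\<Sum>i=1..n. min (p (i - 1)) (p i)) = (\<Sum>i=0..n-1. min (p i) (p (i+1)))"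
    using assms by (intro sum.reindex_bij_witness[of _ Suc "\<lambda>i. i - 1"]) auto
  finally show ?thesis .
qed

text \<open>Each minimum is half the sum minus half the distance of its arguments. Together with
  \<open>p 0 + p n\<close>, the half sums count every \<open>q i\<close> once and every
  \<open>p i\<close> twice, which gives 1 plus the sum of the \<open>p i\<close>.\<close>

lemma bounds_equal:
  assumes "1 \<le> n" "search_distribution n p q"
  shows "p 0 + p n + (\<Sum>i=0..n-1. min (p i) (q (i+1))) + (\<Sum>i=1..n. min (q i) (p i))
      + (\<Sum>i=0..n-1. min (p i) (p (i+1)))
    = 1 - (\<Sum>i=0..n-1. \<bar>p i - q (i+1)\<bar> / 2) - (\<Sum>i=1..n. \<bar>q i - p i\<bar> / 2)
      + (\<Sum>i=0..n. p i) - (\<Sum>i=0..n-1. \<bar>p i - p (i+1)\<bar> / 2)"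
proof -
  have min_eq: "min x y = x / 2 + y / 2 - \<bar>x - y\<bar> / 2" for x y :: real
    by (simp add: min_def field_simps)
  have ivl: "{0..n-1} = {0..<n}" using assms by auto
  have "(\<Sum>i=0..<n. p i / 2) = (\<Sum>i=0..n. p i) / 2 - p n / 2"
    by (simp add: sum_divide_distrib[symmetric] add_divide_distrib atLeast0AtMost atLeast0LessThan
      lessThan_Suc_atMost[symmetric])
  moreover have "(\<Sum>i=1..n. p i / 2) = (\<Sum>i=0..n. p i) / 2 - p 0 / 2"
    by (simp add: sum_divide_distrib[symmetric] add_divide_distrib sum.atLeast_Suc_atMost)
  moreover have "(\<Sum>i=0..<n. p (i + 1) / 2) = (\<Sum>i=1..n. p i / 2)"
    "(\<Sum>i=0..<n. q (i + 1) / 2) = (\<Sum>i=1..n. q i / 2)"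
    by (rule sum.reindex_bij_witness[of _ "\<lambda>i. i - 1" Suc]; auto)+
  moreover have "(\<Sum>i=1..n. q i / 2) = (\<Sum>i=1..n. q i) / 2"
    by (simp add: sum_divide_distrib)
  ultimately show ?thesis
    using assms(2) unfolding min_eq ivl sum.distrib sum_subtractf search_distribution_def
    by argo
qed

section \<open>The two main procedures and the final cost bound\<close>

lemma construct_runs:
  assumes "search_distribution n p q"
  shows "\<exists>A \<mu> t. runs tree_program 4 (VNum (real n)) (input_memory n p q) (code_tree_val A) \<mu> t \<and>
     balanced (\<lambda>x. sigma p q (Suc x)) 0 (2 * n + 1) A \<and> t \<le> 3000 * n + 3000"
proof -
  let ?w = "\<lambda>x. sigma p q (Suc x)"
  have w: "0 \<le> ?w x" if "x < 2 * n + 1" for x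
    using assms that by (auto simp: search_distribution_def sigma_def elim!: oddE evenE)
  have "\<exists>v \<mu>' t. runs tree_program 0 (VPair (VNum (real 0)) (VNum (real (2 * n + 1)))) (input_memory n p q) v \<mu>' t \<and>
     (\<forall>x\<le>2 * n + 1. \<mu>' x = VNum (\<Sum>y<x. ?w y)) \<and> t \<le> 40 * (2 * n + 1 - 0) + 40"
    by (rule prefix_runs) (auto simp: input_memory_def)
  then obtain v \<mu> t where pre: "runs tree_program 0 (VPair (VNum 0) (VNum (1 + 2 * real n))) (input_memory n p q) v \<mu> t"
     "\<And>x. x\<le>2 * n + 1 \<Longrightarrow> \<mu> x = VNum (\<Sum>y<x. ?w y)" "t \<le> 80 * n + 80"
    by auto
  obtain A t' where A: "runs tree_program 3 (VPair (VNum (real 0)) (VNum (real (2 * n)))) \<mu> (code_tree_val A) \<mu> t'"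
    "balanced ?w 0 (2 * n + 1) A"
    "real t' \<le> 1300 * (real (2 * n) + 1 - real 0) - 600 * log 2 (real (2 * n) + 1 - real 0) - 1200"
    using build_runs[of 0 "2 * n" \<mu> ?w] pre(2) w by auto
  have "real t' \<le> 100 + (2600 * real n - 600 * log 2 (2 * real n + 1))"
    using A(3) by simp
  moreover have "0 \<le> log 2 (2 * real n + 1)" by simp
  ultimately have "real t' \<le> 2600 * real n + 100" by linarith
  then have "real t' \<le> real (2600 * n + 100)" by simp
  then have "t' \<le> 2600 * n + 100" by (simp only: of_nat_le_iff)
  with pre(3) have time: "t + t' + 100 \<le> 3000 * n + 3000" by linarith
  have "\<exists>v \<mu>' s. runs tree_program 4 (VNum (real n)) (input_memory n p q) v \<mu>' s \<and>
    v = code_tree_val A \<and> s \<le> 3000 * n + 3000"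
    apply (rule runs_if_wp)
    apply (simp add: program_simps)
    apply (simp add: program_simps)
    apply (rule runs_intro)
    using pre(1) apply simp
    apply (intro exI conjI)
    using A(1) apply simp
    apply (use time in simp)
    done
  then show ?thesis
    using A(2) by blast
qed

lemma move_runs:
  assumes "leaves A = map item [0..<b]" "move_to_lca A = Some T"
  shows "\<exists>t. runs tree_program 6 (code_tree_val A) \<mu> (bst_val T) \<mu> t \<and> t \<le> 200 * b"
proof -
  obtain t where "runs tree_program 5 (code_tree_val A) \<mu> (VPair (VNum 0) (bst_val T)) \<mu> t"
    "t + 100 \<le> 200 * b"
    using contract_runs[OF assms(1), of \<mu>] assms(2) by (auto simp: contraction_val_def)
  then have "\<exists>v \<mu>' s. runs tree_program 6 (code_tree_val A) \<mu> v \<mu>' s \<and>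
    v = bst_val T \<and> \<mu>' = \<mu> \<and> s \<le> 200 * b"
    apply (intro runs_if_wp)
    apply (simp add: program_simps)
    apply (simp add: program_simps)
    apply (intro exI conjI)
    apply assumption
    apply (rule refl)
    apply simp
    done
  then show ?thesis by blast
qed

text \<open>The total weight is 1, so the logarithm of the total vanishes and the path weight is at
  most the entropy plus 2 minus outer weights and minima. The saving contains the sum of the
  \<open>q i\<close>, which turns 2 into 1 plus the sum of the \<open>p i\<close>.\<close>

lemma cost_bound:
  assumes "1 \<le> n" "search_distribution n p q"
    "balanced (\<lambda>x. sigma p q (Suc x)) 0 (2 * n + 1) A" "move_to_lca A = Some T" "search_tree n T"
  shows "cost n p q T \<le> entropy n p q + 1 + (\<Sum>i=0..n. p i)
    - (p 0 + p n + (\<Sum>i=0..n-1. min (p i) (q (i+1))) + (\<Sum>i=1..n. min (q i) (p i))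
       + (\<Sum>i=0..n-1. min (p i) (p (i+1))))"
proof -
  let ?w = "\<lambda>x. sigma p q (Suc x)"
  \<comment> \<open>Transports the weights from positions to items; well behaved because
    \<open>item\<close> is injective.\<close>
  define u where "u = (\<lambda>y. ?w (inv item y))"
  have u: "u (item x) = ?w x" for x
    using inj_item by (simp add: u_def inv_f_f)
  have w: "0 \<le> ?w x" if "x < 2 * n + 1" for x
    using assms that by (auto simp: search_distribution_def sigma_def elim!: oddE evenE)
  have total: "sum ?w {0..<2 * n + 1} = 1"
    using assms(2) unfolding sum_interleaved
    by (simp add: search_distribution_def sigma_def add.commute)
  have ent: "entropy n p q = - (\<Sum>x=0..<2 * n + 1. ?w x * log 2 (?w x))"
    using sum.shift_bounds_cl_Suc_ivl[of "\<lambda>j. sigma p q j * log 2 (sigma p q j)" 0 "2 * n"]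
    by (simp add: entropy_def atLeastLessThanSuc_atLeastAtMost del: sum.cl_ivl_Suc sum.op_ivl_Suc)
  have "cost n p q T = bst_weight u T"
    using assms(5) u by (intro cost_eq_bst_weight) auto
  also have "\<dots> + saving ?w 0 (2 * n + 1) \<le> path_weight u A"
    using leaves_balanced[OF assms(3)] assms(4) w u by (intro bst_weight_add_saving_le) auto
  also have "\<dots> \<le> sum ?w {0..<2 * n + 1} * log 2 (sum ?w {0..<2 * n + 1})
      - (\<Sum>x=0..<2 * n + 1. ?w x * log 2 (?w x)) + 2 * sum ?w {0..<2 * n + 1}
      - ?w 0 - ?w (2 * n + 1 - 1) - (\<Sum>x=0..<2 * n + 1 - 1. min (?w x) (?w (Suc x)))"
    using w u by (intro path_weight_balanced[OF assms(3)]) auto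
  also have "\<dots> = entropy n p q + 2 - p 0 - p n - (\<Sum>x=0..<2 * n. min (?w x) (?w (Suc x)))"
    unfolding total ent by (simp add: sigma_def)
  finally show ?thesis
    using assms(2) unfolding saving_full[OF assms(1)] sum_min_neighbours[OF assms(1)] search_distribution_def
    by linarith
qed

theorem mainTheorem2:
  "\<exists>(Pr :: program) (construct :: nat) (move :: nat) (K :: nat).
     \<forall>(n :: nat) (p :: nat \<Rightarrow> real) (q :: nat \<Rightarrow> real).
       1 \<le> n \<and> search_distribution n p q \<longrightarrow>
         (\<exists>A T \<mu> \<mu>' t t'.
            runs Pr construct (VNum (of_nat n)) (input_memory n p q) (code_tree_val A) \<mu> t \<and>
            alphabetic_tree n A \<and>
            runs Pr move (code_tree_val A) \<mu> (bst_val T) \<mu>' t' \<and>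
            move_to_lca A = Some T \<and>
            t \<le> K * n \<and> t' \<le> K * n \<and>
            search_tree n T \<and>
            cost n p q T \<le>
              entropy n p q + 1 + (\<Sum>i=0..n. p i)
              - (p 0 + p n + (\<Sum>i=0..n-1. min (p i) (q (i+1))) + (\<Sum>i=1..n. min (q i) (p i))
                 + (\<Sum>i=0..n-1. min (p i) (p (i+1)))))
         \<and>
         entropy n p q + 1 + (\<Sum>i=0..n. p i)
         - (p 0 + p n + (\<Sum>i=0..n-1. min (p i) (q (i+1))) + (\<Sum>i=1..n. min (q i) (p i))
            + (\<Sum>i=0..n-1. min (p i) (p (i+1))))
         = entropy n p q + 1 + (\<Sum>i=0..n. p i)
           - (1 - (\<Sum>i=0..n-1. \<bar>p i - q (i+1)\<bar> / 2) - (\<Sum>i=1..n. \<bar>q i - p i\<bar> / 2)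
              + (\<Sum>i=0..n. p i) - (\<Sum>i=0..n-1. \<bar>p i - p (i+1)\<bar> / 2))"
\<comment> \<open>Procedures 4 and 6 are \<open>construct_proc\<close> and \<open>move_proc\<close>.
  Since \<open>n\<close> is at least 1, the factor 6000 absorbs the additive constants in
  \<open>3000 * n + 3000\<close> and \<open>200 * (2 * n + 1)\<close>.\<close>
proof (rule exI[of _ tree_program], rule exI[of _ 4], rule exI[of _ 6], rule exI[of _ 6000],
    intro allI impI conjI; elim conjE)
  fix n p q
  assume n: "1 \<le> n" and d: "search_distribution n p q"
  obtain A \<mu> t where A:
    "runs tree_program 4 (VNum (real n)) (input_memory n p q) (code_tree_val A) \<mu> t"
    "balanced (\<lambda>x. sigma p q (Suc x)) 0 (2 * n + 1) A" "t \<le> 3000 * n + 3000"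
    using construct_runs[OF d] by blast
  note leaves = leaves_balanced[OF A(2)]
  obtain T where T: "move_to_lca A = Some T" "inorder T = map item [0..<2 * n + 1]"
    using move_to_lca_segment[OF leaves] by (auto simp: first_gap_def last_gap_def)
  obtain t' where t': "runs tree_program 6 (code_tree_val A) \<mu> (bst_val T) \<mu> t'" "t' \<le> 200 * (2 * n + 1)"
    using move_runs[OF leaves T(1)] by blast
  have trees: "alphabetic_tree n A" "search_tree n T"
    using leaves T(2) by (simp_all only: alphabetic_tree_def search_tree_def items_in_order_eq)
  have times: "t \<le> 6000 * n" "t' \<le> 6000 * n"
    using A(3) t'(2) n by simp_all
  show "\<exists>A T \<mu> \<mu>' t t'.
            runs tree_program 4 (VNum (of_nat n)) (input_memory n p q) (code_tree_val A) \<mu> t \<and>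
            alphabetic_tree n A \<and>
            runs tree_program 6 (code_tree_val A) \<mu> (bst_val T) \<mu>' t' \<and>
            move_to_lca A = Some T \<and>
            t \<le> 6000 * n \<and> t' \<le> 6000 * n \<and>
            search_tree n T \<and>
            cost n p q T \<le>
              entropy n p q + 1 + (\<Sum>i=0..n. p i)
              - (p 0 + p n + (\<Sum>i=0..n-1. min (p i) (q (i+1))) + (\<Sum>i=1..n. min (q i) (p i))
                 + (\<Sum>i=0..n-1. min (p i) (p (i+1))))"
    using A(1) t'(1) T(1) trees times cost_bound[OF n d A(2) T(1) trees(2)] by blast
qed (simp only: bounds_equal)

end
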